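(* Let $d,n_1,\dots,n_d$ be positive integers, let $\mathbf{r}=(r_1,\dots,r_d)$ be positive integers with $r_k\le n_k$ for all $k$, and let $\mathcal{M}_{\le\mathbf{r}}$ be the set of tensors in $\mathbb{R}^{n_1\times\cdots\times n_d}$ of Tucker rank at most $\mathbf{r}$ (componentwise). Let $\mathcal{X}=\mathcal{G}\times_1\mathbf{U}_1\cdots\times_d\mathbf{U}_d$ be a Tucker decomposition of a tensor with Tucker rank $\underline{\mathbf{r}}=(\underline r_1,\dots,\underline r_d)\le\mathbf{r}$, where $\mathcal{G}\in\mathbb{R}^{\underline r_1\times\cdots\times\underline r_d}$ and $\mathbf{U}_k\in\mathrm{St}(\underline r_k,n_k)$. Then a tensor $\mathcal{V}\in\mathbb{R}^{n_1\times\cdots\times n_d}$ belongs to the Bouligand tangent cone $\mathrm{T}_{\mathcal{X}}\mathcal{M}_{\le\mathbf{r}}$ if and only if it can be written as $$\mathcal{V}=\mathcal{C}\times_{k=1}^d[\mathbf{U}_k\ \ \mathbf{U}_{k,1}]+\sum_{k=1}^d\mathcal{G}\times_k(\mathbf{U}_{k,2}\mathbf{R}_{k,2})\times_{j\ne k}\mathbf{U}_j$$ for some $\mathcal{C}\in\mathbb{R}^{r_1\times\cdots\times r_d}$, $\mathbf{R}_{k,2}\in\mathbb{R}^{(n_k-r_k)\times\underline r_k}$, $\mathbf{U}_{k,1}\in\mathrm{St}(r_k-\underline r_k,n_k)$ and $\mathbf{U}_{k,2}\in\mathrm{St}(n_k-r_k,n_k)$ such that $[\mathbf{U}_k\ \mathbf{U}_{k,1}\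 \mathbf{U}_{k,2}]$ is an orthogonal $n_k\times n_k$ matrix for every $k\in\{1,\dots,d\}$.
   Context: $\mathrm{St}(p,n)=\{\mathbf{X}\in\mathbb{R}^{n\times p}:\mathbf{X}^{\mathsf T}\mathbf{X}=\mathbf{I}_p\}$ (matrices with zero columns are allowed and simply omitted). The mode-$k$ unfolding of $\mathcal{X}\in\mathbb{R}^{n_1\times\cdots\times n_d}$ is the matrix $\mathbf{X}_{(k)}\in\mathbb{R}^{n_k\times n_{-k}}$, $n_{-k}=\prod_{i\ne k}n_i$, whose rows are indexed by $i_k$ and columns by the other indices. The $k$-mode product $\mathcal{X}\times_k\mathbf{A}$ is defined by $(\mathcal{X}\times_k\mathbf{A})_{(k)}=\mathbf{A}\mathbf{X}_{(k)}$; $\times_{k=1}^d\mathbf{A}_k$ and $\times_{j\ne k}\mathbf{A}_j$ denote successive products over the indicated modes. The Tucker rank is $\mathrm{rank}_{\mathrm{tc}}(\mathcal{X})=(\mathrm{rank}(\mathbf{X}_{(1)}),\dots,\mathrm{rank}(\mathbf{X}_{(d)}))$; vector inequalities are componentwise. Any $\mathcal{X}$ of Tucker rank $\underline{\mathbf{r}}$ has a Tucker decomposition $\mathcal{X}=\mathcal{G}\times_{k=1}^d\mathbf{U}_k$ with $\mathcal{G}\in\mathbb{R}^{\underline r_1\times\cdots\times\underline r_d}$, $\mathbf{U}_k\in\mathrm{St}(\underline r_k,n_k)$. The (Bouligand) tangent cone of a set $C$ at $\mathcal{X}\in C$ is $\mathrm{T}_{\mathcal{X}}C=\{\mathcal{V}:\exists\,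 t^{(i)}>0,\ t^{(i)}\to0,\ \mathcal{X}^{(i)}\in C,\ \mathcal{X}^{(i)}\to\mathcal{X},\ (\mathcal{X}^{(i)}-\mathcal{X})/t^{(i)}\to\mathcal{V}\}$. *)

theory Defs
  imports
    "HOL-Analysis.Function_Topology"
    "Jordan_Normal_Form.DL_Rank"
begin

section \<open>Tensors\<close>

text \<open>
  A tensor of size \<open>n\<^sub>1 \<times> \<dots> \<times> n\<^sub>d\<close> is a function on multi-indices that vanishes outside the
  index set of \<open>ns = [n\<^sub>1, \<dots>, n\<^sub>d]\<close>. Modes and indices are counted from 0. Because of the
  vanishing, equality of tensors is equality of functions, and the product topology of
  \<^typ>\<open>nat list \<Rightarrow> real\<close> induces on \<open>tensors ns\<close> the usual topology of a
  finite-dimensional space.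
\<close>

type_synonym tensor = "nat list \<Rightarrow> real"

definition indices :: "nat list \<Rightarrow> nat list set" where
  "indices ns = {is. list_all2 (<) is ns}"

definition tensors :: "nat list \<Rightarrow> tensor set" where
  "tensors ns = {X. \<forall>is. is \<notin> indices ns \<longrightarrow> X is = 0}"

definition insert_at :: "nat \<Rightarrow> 'a \<Rightarrow> 'a list \<Rightarrow> 'a list" where
  "insert_at k i js = take k js @ i # drop k js"

definition remove_at :: "nat \<Rightarrow> 'a list \<Rightarrow> 'a list" where
  "remove_at k is = take k is @ drop (Suc k) is"

text \<open>The columns of an unfolding are enumerated in lexicographic order.\<close>

definition unfolding_cols :: "nat list \<Rightarrow> nat \<Rightarrow> nat list list" where
  "unfolding_cols ns k = product_lists (map (\<lambda>n. [0..<n]) (remove_at k ns))"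

definition unfold_mode :: "nat list \<Rightarrow> nat \<Rightarrow> tensor \<Rightarrow> real mat" where
  "unfold_mode ns k X =
     mat (ns ! k) (length (unfolding_cols ns k))
       (\<lambda>(i, c). X (insert_at k i (unfolding_cols ns k ! c)))"

definition tucker_rank :: "nat list \<Rightarrow> tensor \<Rightarrow> nat list" where
  "tucker_rank ns X = map (\<lambda>k. vec_space.rank (ns ! k) (unfold_mode ns k X)) [0..<length ns]"

definition tucker_variety :: "nat list \<Rightarrow> nat list \<Rightarrow> tensor set" where
  "tucker_variety ns rs = {X \<in> tensors ns. list_all2 (\<le>) (tucker_rank ns X) rs}"

text \<open>
  The \<open>k\<close>-mode product by entries; the lemmas \<open>unfold_mode_prod\<close> and \<open>unfold_mode_inject\<close> below
  show that it is the unique tensor whose mode-\<open>k\<close> unfolding is \<open>A\<close> times the mode-\<open>k\<close>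
  unfolding of \<open>X\<close>.
\<close>

definition mode_prod :: "tensor \<Rightarrow> nat \<Rightarrow> real mat \<Rightarrow> tensor" where
  "mode_prod X k A = (\<lambda>is.
     if k < length is \<and> is ! k < dim_row A
     then \<Sum>j<dim_col A. A $$ (is ! k, j) * X (is[k := j]) else 0)"

definition mode_prods :: "nat list \<Rightarrow> tensor \<Rightarrow> (nat \<Rightarrow> real mat) \<Rightarrow> tensor" where
  "mode_prods ks X A = fold (\<lambda>k Y. mode_prod Y k (A k)) ks X"

lemma length_unfolding_cols: "length (unfolding_cols ns k) = prod_list (remove_at k ns)"
proof -
  have "length (product_lists (map (\<lambda>n. [0..<n]) ms)) = prod_list ms" for ms :: "nat list"
    by (induction ms) (simp_all add: length_concat comp_def sum_list_triv)
  then show ?thesis by (simp add: unfolding_cols_def)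
qed

lemma set_unfolding_cols: "set (unfolding_cols ns k) = indices (remove_at k ns)"
  by (auto simp: unfolding_cols_def product_lists_set indices_def list_all2_conv_all_nth)

lemma insert_at_remove_at:
  assumes "k < length is"
  shows "insert_at k i (remove_at k is) = is[k := i]"
  using assms by (simp add: insert_at_def remove_at_def upd_conv_take_nth_drop)

lemma insert_at_in_indices:
  assumes "k < length ns" "js \<in> indices (remove_at k ns)" "i < ns ! k"
  shows "insert_at k i js \<in> indices ns"
proof -
  have js: "list_all2 (<) js (take k ns @ drop (Suc k) ns)"
    using assms(2) by (simp add: indices_def remove_at_def)
  have "list_all2 (<) (take k js) (take k ns)"
    using list_all2_takeI[OF js, of k] assms(1) by simp
  moreover have "list_all2 (<) (drop k js) (drop (Suc k) ns)"
    using list_all2_dropI[OF js, of k] assms(1) by simp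
  ultimately have "list_all2 (<) (take k js @ i # drop k js) (take k ns @ ns ! k # drop (Suc k) ns)"
    using assms(3) by (intro list_all2_appendI) auto
  then show ?thesis
    using assms(1) by (simp add: indices_def insert_at_def id_take_nth_drop[symmetric])
qed

lemma remove_at_in_indices:
  assumes "is \<in> indices ns"
  shows "remove_at k is \<in> indices (remove_at k ns)"
  using assms unfolding indices_def remove_at_def
  by (auto intro!: list_all2_appendI list_all2_takeI list_all2_dropI)

lemma remove_at_update [simp]: "remove_at k (ns[k := m]) = remove_at k ns"
  by (simp add: remove_at_def)

lemma unfolding_cols_update [simp]: "unfolding_cols (ns[k := m]) k = unfolding_cols ns k"
  by (simp add: unfolding_cols_def)

lemma mode_prod_in_tensors:
  assumes X: "X \<in> tensors ns" and k: "k < length ns" and A: "A \<in> carrier_mat m (ns ! k)"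
  shows "mode_prod X k A \<in> tensors (ns[k := m])"
proof -
  have "mode_prod X k A is = 0" if "is \<notin> indices (ns[k := m])" for "is"
  proof (cases "k < length is \<and> is ! k < m")
    case True
    have "is[k := j] \<notin> indices ns" for j
    proof
      assume "is[k := j] \<in> indices ns"
      then have "length is = length ns" and *: "\<And>l. l < length ns \<Longrightarrow> is[k := j] ! l < ns ! l"
        by (auto simp: indices_def list_all2_conv_all_nth)
      moreover have "is ! l < ns[k := m] ! l" if "l < length ns" for l
        using *[OF that] True that by (cases "l = k") auto
      ultimately show False
        using that by (auto simp: indices_def list_all2_conv_all_nth)
    qed
    then show ?thesis using X A by (simp add: mode_prod_def tensors_def)
  next
    case False
    then show ?thesis using A by (auto simp: mode_prod_def)
  qed
  then show ?thesis by (simp add: tensors_def)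
qed

lemma unfold_mode_prod:
  assumes k: "k < length ns" and A: "A \<in> carrier_mat m (ns ! k)"
  shows "unfold_mode (ns[k := m]) k (mode_prod X k A) = A * unfold_mode ns k X"
proof (rule eq_matI)
  fix i c
  assume "i < dim_row (A * unfold_mode ns k X)" "c < dim_col (A * unfold_mode ns k X)"
  then have i: "i < m" and c: "c < length (unfolding_cols ns k)"
    using A by (auto simp: unfold_mode_def)
  let ?js = "unfolding_cols ns k ! c"
  have "?js \<in> indices (remove_at k ns)"
    using c set_unfolding_cols by (metis nth_mem)
  then have len: "k \<le> length ?js"
    using k by (auto simp: indices_def remove_at_def dest: list_all2_lengthD)
  then have ins: "(insert_at k i ?js)[k := j] = insert_at k j ?js"
    "insert_at k i ?js ! k = i" "k < length (insert_at k i ?js)" for j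
    by (simp_all add: insert_at_def list_update_append nth_append)
  show "unfold_mode (ns[k := m]) k (mode_prod X k A) $$ (i, c) = (A * unfold_mode ns k X) $$ (i, c)"
    using i c A k ins
    by (simp add: unfold_mode_def mode_prod_def scalar_prod_def lessThan_atLeast0)
qed (use A k in \<open>auto simp: unfold_mode_def\<close>)

lemma unfold_mode_inject:
  assumes "X \<in> tensors ns" "Y \<in> tensors ns" and k: "k < length ns"
    and eq: "unfold_mode ns k X = unfold_mode ns k Y"
  shows "X = Y"
proof
  fix "is"
  show "X is = Y is"
  proof (cases "is \<in> indices ns")
    case True
    then have len: "k < length is" and i: "is ! k < ns ! k"
      using k by (auto simp: indices_def list_all2_conv_all_nth)
    obtain c where c: "c < length (unfolding_cols ns k)" "unfolding_cols ns k ! c = remove_at k is"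
      using remove_at_in_indices[OF True, of k] set_unfolding_cols by (metis in_set_conv_nth)
    have "unfold_mode ns k Z $$ (is ! k, c) = Z is" for Z
      using i c insert_at_remove_at[OF len, of "is ! k"] by (simp add: unfold_mode_def)
    then show ?thesis using eq by metis
  qed (use assms in \<open>simp add: tensors_def\<close>)
qed


section \<open>Orthonormal columns\<close>

definition stiefel :: "nat \<Rightarrow> nat \<Rightarrow> real mat set" where
  "stiefel p n = {A \<in> carrier_mat n p. transpose_mat A * A = 1\<^sub>m p}"

definition orthogonal_matrices :: "nat \<Rightarrow> real mat set" where
  "orthogonal_matrices n =
     {A \<in> carrier_mat n n. transpose_mat A * A = 1\<^sub>m n \<and> A * transpose_mat A = 1\<^sub>m n}"

definition append_cols :: "real mat \<Rightarrow> real mat \<Rightarrow> real mat" (infixr \<open>@\<^sub>c\<close> 65) where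
  "A @\<^sub>c B = mat (dim_row A) (dim_col A + dim_col B)
     (\<lambda>(i, j). if j < dim_col A then A $$ (i, j) else B $$ (i, j - dim_col A))"


section \<open>Bouligand tangent cone\<close>

definition tangent_cone :: "tensor set \<Rightarrow> tensor \<Rightarrow> tensor set" where
  "tangent_cone S X = {V. \<exists>(t :: nat \<Rightarrow> real) (Y :: nat \<Rightarrow> tensor).
     (\<forall>i. 0 < t i) \<and> t \<longlonglongrightarrow> 0 \<and> (\<forall>i. Y i \<in> S) \<and> Y \<longlonglongrightarrow> X \<and>
     (\<lambda>i is. (Y i is - X is) / t i) \<longlonglongrightarrow> V}"

end

theory Submission
  imports Defs
begin

text \<open>
  Write \<open>P\<^sub>k\<close> for an orthogonal projector of rank \<open>r\<^sub>k\<close> on the mode-\<open>k\<close> space. A tensor \<open>Y\<close> lies in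
  the variety exactly when, for every mode, some such projector satisfies \<open>Y \<times>\<^sub>k P\<^sub>k = Y\<close>. The proof
  looks at the variety through these projectors.

  Tangent vectors of the stated form are velocities of curves. Pad \<open>G\<close> with zeros to size \<open>rs\<close>; then
  \<open>(G + t C) \<times>\<^sub>k [U\<^sub>k + t Z\<^sub>k, U\<^sub>k\<^sub>,\<^sub>1]\<close>, with \<open>Z\<^sub>k = U\<^sub>k\<^sub>,\<^sub>2 R\<^sub>k\<^sub>,\<^sub>2\<close>, is a Tucker decomposition with core of size
  \<open>rs\<close>, so it stays in the variety, and the product rule for mode products gives the required
  derivative at \<open>t = 0\<close> (\<open>tucker_curve_tangent\<close>).

  Conversely, let \<open>(Y\<^sub>i - X) / t\<^sub>i\<close> tend to \<open>V\<close>, with \<open>Y\<^sub>i\<close> in the variety and fixed by projectors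
  \<open>P\<^sub>i\<^sub>,\<^sub>k = W\<^sub>i\<^sub>,\<^sub>k W\<^sub>i\<^sub>,\<^sub>k\<^sup>T\<close>. Matrices with orthonormal columns form a compact set, so along a subsequence
  \<open>W\<^sub>i\<^sub>,\<^sub>k\<close> tends to some \<open>W\<^sub>k\<close>, and \<open>P\<^sub>k = W\<^sub>k W\<^sub>k\<^sup>T\<close> fixes \<open>X\<close>. Since \<open>I - P\<^sub>i\<^sub>,\<^sub>k\<close> kills \<open>Y\<^sub>i\<close>, the tensor
  \<open>V \<times>\<^sub>k (I - P\<^sub>k)\<close> is the limit of \<open>- X \<times>\<^sub>k (I - P\<^sub>i\<^sub>,\<^sub>k) / t\<^sub>i\<close>. The rows of the unfoldings of these
  tensors all lie in the row space of the unfolding of \<open>X\<close>, which is closed, and so do those of the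
  limit (\<open>tangent_cone_normal_rows\<close>). Hence \<open>V \<times>\<^sub>k (I - P\<^sub>k)\<close> is a term
  \<open>T\<^sub>k = G \<times>\<^sub>k (U\<^sub>k\<^sub>,\<^sub>2 R\<^sub>k\<^sub>,\<^sub>2) \<times>\<^sub>j\<^sub>\<noteq>\<^sub>k U\<^sub>j\<close>. Each \<open>T\<^sub>k\<close> is fixed by \<open>P\<^sub>j\<close> for \<open>j \<noteq> k\<close>, so splitting \<open>V\<close> by
  \<open>I = P\<^sub>k + (I - P\<^sub>k)\<close> one mode after the other gives \<open>V = V \<times>\<^sub>1 P\<^sub>1 \<dots> \<times>\<^sub>d P\<^sub>d + \<Sum>\<^sub>k T\<^sub>k\<close>
  (\<open>tensor_telescope\<close>). The range of \<open>P\<^sub>k\<close> contains that of \<open>U\<^sub>k\<close>, because \<open>X\<close> has Tucker rank exactly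
  \<open>rs'\<close>, so \<open>P\<^sub>k = [U\<^sub>k U\<^sub>k\<^sub>,\<^sub>1] [U\<^sub>k U\<^sub>k\<^sub>,\<^sub>1]\<^sup>T\<close> for a suitable \<open>U\<^sub>k\<^sub>,\<^sub>1\<close> (\<open>orthonormal_split\<close>), and the first
  summand has the form \<open>C \<times>\<^sub>k [U\<^sub>k U\<^sub>k\<^sub>,\<^sub>1]\<close>.
\<close>

section \<open>Rank factorizations\<close>

lemma index_mult_mat_sum:
  assumes "A \<in> carrier_mat n p" "B \<in> carrier_mat p m" "i < n" "j < m"
  shows "(A * B) $$ (i, j) = (\<Sum>l<p. A $$ (i, l) * B $$ (l, j))"
  using assms by (simp add: scalar_prod_def lessThan_atLeast0)

text \<open>
  Padding \<open>A\<close> with zero rows to a square matrix makes the determinant vanish.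
\<close>

lemma wide_mat_kernel:
  fixes A :: "'a :: field mat"
  assumes A: "A \<in> carrier_mat p n" and "p < n"
  shows "\<exists>v \<in> carrier_vec n. v \<noteq> 0\<^sub>v n \<and> A *\<^sub>v v = 0\<^sub>v p"
proof -
  define A' where "A' = mat\<^sub>r n n (\<lambda>i. if i = p then 0\<^sub>v n else if i < p then row A i else 0\<^sub>v n)"
  have A': "A' \<in> carrier_mat n n" by (simp add: A'_def)
  have "(\<lambda>i. if i < p then row A i else 0\<^sub>v n) \<in> {0..<n} \<rightarrow> carrier_vec n"
    using A by (auto simp: row_carrier_vec)
  from det_row_0[OF \<open>p < n\<close> this] have "det A' = 0"
    by (simp add: A'_def)
  then obtain v where v: "v \<in> carrier_vec n" "v \<noteq> 0\<^sub>v n" "A' *\<^sub>v v = 0\<^sub>v n"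
    using det_0_iff_vec_prod_zero_field[OF A'] by blast
  have "(A *\<^sub>v v) $ i = 0" if "i < p" for i
  proof -
    have "row A' i = row A i"
      using that \<open>p < n\<close> A by (auto simp: A'_def)
    then have "(A *\<^sub>v v) $ i = (A' *\<^sub>v v) $ i"
      using that \<open>p < n\<close> A A' by simp
    then show ?thesis using v that \<open>p < n\<close> by simp
  qed
  then have "A *\<^sub>v v = 0\<^sub>v p" using A by (intro eq_vecI) auto
  with v show ?thesis by blast
qed

lemma (in vec_space) maximal_independent_columns:
  assumes A: "A \<in> carrier_mat n m"
  obtains xs where "distinct xs" "maximal (set xs) (\<lambda>T. T \<subseteq> set (cols A) \<and> lin_indpt T)"
    "set xs \<subseteq> set (cols A)" "lin_indpt (set xs)" "set xs \<subseteq> carrier_vec n" "rank A = length xs"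
proof -
  obtain S where S: "maximal S (\<lambda>T. T \<subseteq> set (cols A) \<and> lin_indpt T)"
    using maximal_exists[of "(\<lambda>T. T \<subseteq> set (cols A) \<and> lin_indpt T)" "card (set (cols A))" "{}"]
    by (meson List.finite_set card_mono empty_iff empty_subsetI finite_lin_indpt2 rev_finite_subset)
  then have sub: "S \<subseteq> set (cols A)" and ind: "lin_indpt S" by (auto simp: maximal_def)
  from sub obtain xs where xs: "set xs = S" "distinct xs"
    by (meson List.finite_set finite_distinct_list rev_finite_subset)
  have "rank A = length xs"
    using rank_card_indpt[OF A S] xs by (simp add: distinct_card[symmetric])
  moreover have "S \<subseteq> carrier_vec n" using sub cols_dim[of A] A by auto
  ultimately show ?thesis using that[of xs] xs S sub ind by simp
qed

text \<open>
  More than \<open>r\<close> independent columns of \<open>W * B\<close> would form a matrix \<open>M = W * E\<close> in which \<open>E\<close> has more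
  columns than rows; a kernel vector of \<open>E\<close> is then a linear dependence between the columns of \<open>M\<close>.
\<close>

lemma (in vec_space) rank_mult_le:
  assumes W: "W \<in> carrier_mat n r" and B: "B \<in> carrier_mat r m"
  shows "rank (W * B) \<le> r"
proof -
  let ?A = "W * B"
  have A: "?A \<in> carrier_mat n m" using W B by simp
  obtain xs where xs: "distinct xs" "set xs \<subseteq> set (cols ?A)" "lin_indpt (set xs)"
    and xsc: "set xs \<subseteq> carrier_vec n" and rank: "rank ?A = length xs"
    using maximal_independent_columns[OF A] .
  define q where "q = length xs"
  define M where "M = mat_of_cols n xs"
  have M: "M \<in> carrier_mat n q" by (simp add: M_def q_def)
  have colsM: "cols M = xs" using xsc by (simp add: M_def)
  have "\<exists>j<m. xs ! i = col ?A j" if "i < q" for i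
  proof -
    have "xs ! i \<in> set (cols ?A)" using that xs by (auto simp: q_def)
    then show ?thesis using A W B by (auto simp: cols_def)
  qed
  then obtain j where j: "\<And>i. i < q \<Longrightarrow> j i < m \<and> xs ! i = col ?A (j i)" by metis
  define E where "E = mat r q (\<lambda>(a, i). B $$ (a, j i))"
  have E: "E \<in> carrier_mat r q" by (simp add: E_def)
  have ME: "M = W * E"
  proof (rule eq_matI)
    fix a i assume "a < dim_row (W * E)" "i < dim_col (W * E)"
    then have ai: "a < n" "i < q" using W E by auto
    have "M $$ (a, i) = ?A $$ (a, j i)"
      using ai j[OF ai(2)] W B by (simp add: M_def mat_of_cols_def q_def)
    also have "\<dots> = (W * E) $$ (a, i)"
      using ai j[OF ai(2)] W B E by (simp add: scalar_prod_def E_def)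
    finally show "M $$ (a, i) = (W * E) $$ (a, i)" .
  qed (use M W E in auto)
  have "q \<le> r"
  proof (rule ccontr)
    assume "\<not> q \<le> r"
    then obtain v where v: "v \<in> carrier_vec q" "v \<noteq> 0\<^sub>v q" "E *\<^sub>v v = 0\<^sub>v r"
      using wide_mat_kernel[OF E] by auto
    have "M *\<^sub>v v = W *\<^sub>v (E *\<^sub>v v)" unfolding ME using W E v by (simp add: assoc_mult_mat_vec)
    also have "\<dots> = 0\<^sub>v n" using v W by (auto intro!: eq_vecI simp: scalar_prod_def)
    finally have "lin_dep (set (cols M))"
      using lin_depI[OF M v(1,2)] colsM xs by simp
    then show False using colsM xs by simp
  qed
  then show ?thesis using rank by (simp add: q_def)
qed

text \<open>
  The factor \<open>M\<close> consists of a maximal independent set of columns of \<open>A\<close>, and \<open>D\<close> holds the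
  coordinates of all columns of \<open>A\<close> in it.
\<close>

lemma (in vec_space) rank_factorization:
  assumes A: "A \<in> carrier_mat n m"
  obtains M D where "M \<in> carrier_mat n (rank A)" "D \<in> carrier_mat (rank A) m" "A = M * D"
proof -
  obtain xs where S: "maximal (set xs) (\<lambda>T. T \<subseteq> set (cols A) \<and> lin_indpt T)"
    and sub: "set xs \<subseteq> set (cols A)" and ind: "lin_indpt (set xs)"
    and Sc: "set xs \<subseteq> carrier_vec n" and q: "rank A = length xs"
    using maximal_independent_columns[OF A] .
  let ?S = "set xs"
  have Ac: "set (cols A) \<subseteq> carrier_vec n" using cols_dim[of A] A by auto
  define M where "M = mat_of_cols n xs"
  have M: "M \<in> carrier_mat n (rank A)" by (simp add: M_def q)
  have colsM: "set (cols M) = ?S" using Sc by (simp add: M_def)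
  have "c \<in> span ?S" if c: "c \<in> set (cols A)" for c
  proof (rule ccontr)
    assume "c \<notin> span ?S"
    have "c \<notin> ?S" using \<open>c \<notin> span ?S\<close> span_mem[OF Sc] by blast
    have "lin_indpt (?S \<union> {c})"
      using lin_dep_iff_in_span[of ?S c] Sc ind \<open>c \<notin> ?S\<close> \<open>c \<notin> span ?S\<close> c Ac by auto
    then have "?S \<union> {c} = ?S" using S c sub unfolding maximal_def by (metis Un_subset_iff Un_upper1 empty_subsetI insert_subset)
    then show False using \<open>c \<notin> ?S\<close> by blast
  qed
  then have "\<exists>x\<in>carrier_vec (rank A). M *\<^sub>v x = col A j" if "j < m" for j
    using col_space_eq[OF M] colsM that A M by (fastforce simp: col_space_def cols_def)
  then obtain x where x: "\<And>j. j < m \<Longrightarrow> x j \<in> carrier_vec (rank A) \<and> M *\<^sub>v x j = col A j"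
    by metis
  define D where "D = mat (rank A) m (\<lambda>(i, j). x j $ i)"
  have "A = M * D"
  proof (rule eq_matI)
    fix i j assume "i < dim_row (M * D)" "j < dim_col (M * D)"
    then have ij: "i < n" "j < m" using M by (auto simp: D_def)
    then have "A $$ (i, j) = (M *\<^sub>v x j) $ i" using x A by simp
    also have "\<dots> = (M * D) $$ (i, j)"
    proof -
      have "x j \<in> carrier_vec (rank A)" using x[OF ij(2)] by blast
      then show ?thesis using ij M by (simp add: D_def scalar_prod_def)
    qed
    finally show "A $$ (i, j) = (M * D) $$ (i, j)" .
  qed (use A M in \<open>auto simp: D_def\<close>)
  moreover have "D \<in> carrier_mat (rank A) m" by (simp add: D_def)
  ultimately show ?thesis using that[OF M] by blast
qed

section \<open>Block columns and orthonormal completion\<close>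

lemma append_cols_carrier [intro]:
  "A \<in> carrier_mat n p \<Longrightarrow> B \<in> carrier_mat n q \<Longrightarrow> A @\<^sub>c B \<in> carrier_mat n (p + q)"
  by (auto simp: append_cols_def)

lemma index_append_cols:
  assumes "A \<in> carrier_mat n p" "B \<in> carrier_mat n q" "i < n" "j < p + q"
  shows "(A @\<^sub>c B) $$ (i, j) = (if j < p then A $$ (i, j) else B $$ (i, j - p))"
  using assms by (simp add: append_cols_def)

lemma mult_append_cols:
  fixes M :: "real mat"
  assumes "M \<in> carrier_mat m n" "A \<in> carrier_mat n p" "B \<in> carrier_mat n q"
  shows "M * (A @\<^sub>c B) = M * A @\<^sub>c M * B"
  using assms by (intro eq_matI) (auto simp: append_cols_def scalar_prod_def)

text \<open>
  If \<open>C = A\<close>, \<open>D = B\<close> and all columns together are orthonormal, this splits the projector onto their span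
  into the projectors of the two blocks.
\<close>

lemma append_cols_gram:
  fixes A B C D :: "real mat"
  assumes "A \<in> carrier_mat n p" "B \<in> carrier_mat n q" "C \<in> carrier_mat m p" "D \<in> carrier_mat m q"
  shows "(A @\<^sub>c B) * transpose_mat (C @\<^sub>c D) = A * transpose_mat C + B * transpose_mat D"
proof (rule eq_matI)
  fix i j
  assume "i < dim_row (A * transpose_mat C + B * transpose_mat D)"
    "j < dim_col (A * transpose_mat C + B * transpose_mat D)"
  then have ij: "i < n" "j < m" using assms by auto
  have split: "(\<Sum>l<p+q. f l) = (\<Sum>l<p. f l) + (\<Sum>l<q. f (p + l))" for f :: "nat \<Rightarrow> real"
    by (induction q) (simp_all add: ac_simps)
  show "((A @\<^sub>c B) * transpose_mat (C @\<^sub>c D)) $$ (i, j) =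
    (A * transpose_mat C + B * transpose_mat D) $$ (i, j)"
    using ij assms by (simp add: scalar_prod_def append_cols_def lessThan_atLeast0[symmetric] split)
qed (use assms in \<open>auto simp: append_cols_def\<close>)

lemma transpose_mult_append_cols:
  fixes A B :: "real mat"
  assumes "A \<in> carrier_mat n p" "B \<in> carrier_mat n q" "N \<in> carrier_mat n m"
    and "transpose_mat (A @\<^sub>c B) * N = 0\<^sub>m (p + q) m"
  shows "transpose_mat A * N = 0\<^sub>m p m" "transpose_mat B * N = 0\<^sub>m q m"
proof -
  have *: "(transpose_mat (A @\<^sub>c B) * N) $$ (i, j) = 0" if "i < p + q" "j < m" for i j
    using assms(4) that by simp
  show "transpose_mat A * N = 0\<^sub>m p m"
  proof (rule eq_matI)
    fix i j assume "i < dim_row (0\<^sub>m p m :: real mat)" "j < dim_col (0\<^sub>m p m :: real mat)"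
    then show "(transpose_mat A * N) $$ (i, j) = 0\<^sub>m p m $$ (i, j)"
      using assms(1-3) *[of i j] by (simp add: scalar_prod_def append_cols_def)
  qed (use assms in auto)
  show "transpose_mat B * N = 0\<^sub>m q m"
  proof (rule eq_matI)
    fix i j assume "i < dim_row (0\<^sub>m q m :: real mat)" "j < dim_col (0\<^sub>m q m :: real mat)"
    then show "(transpose_mat B * N) $$ (i, j) = 0\<^sub>m q m $$ (i, j)"
      using assms(1-3) *[of "p + i" j] by (simp add: scalar_prod_def append_cols_def)
  qed (use assms in auto)
qed

lemma stiefel_append_cols:
  assumes A: "A \<in> stiefel p n" and B: "B \<in> stiefel q n" and AB: "transpose_mat A * B = 0\<^sub>m p q"
  shows "A @\<^sub>c B \<in> stiefel (p + q) n"
proof -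
  have Ac: "A \<in> carrier_mat n p" and Bc: "B \<in> carrier_mat n q"
    using A B by (auto simp: stiefel_def)
  have AA: "(\<Sum>l<n. A $$ (l, i) * A $$ (l, j)) = (if i = j then 1 else 0)" if "i < p" "j < p" for i j
  proof -
    have "(transpose_mat A * A) $$ (i, j) = 1\<^sub>m p $$ (i, j)" using A by (simp add: stiefel_def)
    then show ?thesis using that Ac by (simp add: scalar_prod_def lessThan_atLeast0)
  qed
  have BB: "(\<Sum>l<n. B $$ (l, i) * B $$ (l, j)) = (if i = j then 1 else 0)" if "i < q" "j < q" for i j
  proof -
    have "(transpose_mat B * B) $$ (i, j) = 1\<^sub>m q $$ (i, j)" using B by (simp add: stiefel_def)
    then show ?thesis using that Bc by (simp add: scalar_prod_def lessThan_atLeast0)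
  qed
  have AB': "(\<Sum>l<n. A $$ (l, i) * B $$ (l, j)) = 0" if "i < p" "j < q" for i j
  proof -
    have "(transpose_mat A * B) $$ (i, j) = 0\<^sub>m p q $$ (i, j)" using AB by simp
    then show ?thesis using that Ac Bc by (simp add: scalar_prod_def lessThan_atLeast0)
  qed
  have "transpose_mat (A @\<^sub>c B) * (A @\<^sub>c B) = 1\<^sub>m (p + q)"
  proof (rule eq_matI)
    fix i j assume "i < dim_row (1\<^sub>m (p + q) :: real mat)" "j < dim_col (1\<^sub>m (p + q) :: real mat)"
    then have ij: "i < p + q" "j < p + q" by auto
    have "(transpose_mat (A @\<^sub>c B) * (A @\<^sub>c B)) $$ (i, j) =
        (\<Sum>l<n. (A @\<^sub>c B) $$ (l, i) * (A @\<^sub>c B) $$ (l, j))"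
      using ij Ac Bc by (simp add: scalar_prod_def append_cols_def lessThan_atLeast0)
    also have "\<dots> = 1\<^sub>m (p + q) $$ (i, j)"
      using ij AA BB AB' AB'[of j "i - p"] Ac Bc
      by (cases "i < p"; cases "j < p") (auto simp: index_append_cols mult.commute)
    finally show "(transpose_mat (A @\<^sub>c B) * (A @\<^sub>c B)) $$ (i, j) = 1\<^sub>m (p + q) $$ (i, j)" .
  qed (use Ac Bc in \<open>auto simp: append_cols_def\<close>)
  then show ?thesis using Ac Bc by (auto simp: stiefel_def)
qed

lemma stiefel_0: "mat n 0 f \<in> stiefel 0 n"
  by (auto simp: stiefel_def)

lemma wide_mat_unit_kernel:
  fixes A :: "real mat"
  assumes A: "A \<in> carrier_mat p n" and "p < n"
  obtains N where "N \<in> stiefel 1 n" "A * N = 0\<^sub>m p 1"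
proof -
  obtain v where v: "v \<in> carrier_vec n" "v \<noteq> 0\<^sub>v n" "A *\<^sub>v v = 0\<^sub>v p"
    using wide_mat_kernel[OF assms] by blast
  define s where "s = (\<Sum>i<n. v $ i * v $ i)"
  have "v \<bullet> v > 0"
    using v conjugate_square_greater_0_vec[of v n] by simp
  then have s: "s > 0" using v by (simp add: s_def scalar_prod_def lessThan_atLeast0)
  define N where "N = mat n 1 (\<lambda>(i, j). v $ i / sqrt s)"
  have N: "N \<in> carrier_mat n 1" by (simp add: N_def)
  have "transpose_mat N * N = 1\<^sub>m 1"
  proof (rule eq_matI)
    fix i j assume "i < dim_row (1\<^sub>m 1)" "j < dim_col (1\<^sub>m 1)"
    then have "(transpose_mat N * N) $$ (i, j) = (\<Sum>i<n. v $ i * v $ i / s)"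
      using s by (simp add: N_def scalar_prod_def lessThan_atLeast0)
    also have "\<dots> = 1" using s by (simp add: sum_divide_distrib[symmetric] s_def)
    finally show "(transpose_mat N * N) $$ (i, j) = 1\<^sub>m 1 $$ (i, j)"
      using \<open>i < _\<close> \<open>j < _\<close> by simp
  qed (simp_all add: N_def)
  moreover have "A * N = 0\<^sub>m p 1"
  proof (rule eq_matI)
    fix i j assume "i < dim_row (0\<^sub>m p 1 :: real mat)" "j < dim_col (0\<^sub>m p 1 :: real mat)"
    then have ij: "i < p" "j = 0" by auto
    have "(\<Sum>l<n. A $$ (i, l) * v $ l) = (A *\<^sub>v v) $ i"
      using ij A v(1) by (simp add: scalar_prod_def lessThan_atLeast0)
    then have "(\<Sum>l<n. A $$ (i, l) * v $ l) = 0" using v(3) ij by simp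
    then show "(A * N) $$ (i, j) = 0\<^sub>m p 1 $$ (i, j)"
      using ij A by (simp add: N_def scalar_prod_def lessThan_atLeast0 sum_divide_distrib[symmetric])
  qed (use A N in auto)
  ultimately show ?thesis using that N by (simp add: stiefel_def)
qed

text \<open>
  The columns of \<open>T\<close> are found one at a time: as long as fewer than \<open>n\<close> vectors are to be avoided, the
  transpose of the block matrix of these vectors is wide, so its kernel contains a unit vector.
\<close>

lemma orthonormal_complement:
  fixes B :: "real mat"
  assumes B: "B \<in> carrier_mat n q" and "m + q \<le> n"
  obtains T where "T \<in> stiefel m n" "transpose_mat B * T = 0\<^sub>m q m"
  using \<open>m + q \<le> n\<close>
proof (induction m arbitrary: thesis)
  case 0
  have "transpose_mat B * mat n 0 f = 0\<^sub>m q 0" for f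
    using B by (intro eq_matI) auto
  then show ?case using 0(1)[OF stiefel_0] by blast
next
  case (Suc m)
  then obtain T where T: "T \<in> stiefel m n" "transpose_mat B * T = 0\<^sub>m q m" by auto
  then have Tc: "T \<in> carrier_mat n m" by (simp add: stiefel_def)
  have "transpose_mat (B @\<^sub>c T) \<in> carrier_mat (q + m) n" using B Tc by auto
  then obtain N where N: "N \<in> stiefel 1 n" "transpose_mat (B @\<^sub>c T) * N = 0\<^sub>m (q + m) 1"
    using Suc.prems(2) by (elim wide_mat_unit_kernel) auto
  then have Nc: "N \<in> carrier_mat n 1" by (simp add: stiefel_def)
  note orth = transpose_mult_append_cols[OF B Tc Nc N(2)]
  have "T @\<^sub>c N \<in> stiefel (Suc m) n" using stiefel_append_cols[OF T(1) N(1) orth(2)] by simp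
  moreover have "transpose_mat B * (T @\<^sub>c N) = 0\<^sub>m q (Suc m)"
    unfolding mult_append_cols[OF transpose_carrier_mat[THEN iffD2, OF B] Tc Nc] T(2) orth(1)
    by (intro eq_matI) (auto simp: append_cols_def)
  ultimately show ?case using Suc.prems(1) by blast
qed

lemma stiefelD:
  assumes "A \<in> stiefel p n"
  shows "A \<in> carrier_mat n p" "transpose_mat A \<in> carrier_mat p n" "transpose_mat A * A = 1\<^sub>m p"
  using assms by (auto simp: stiefel_def)

lemma stiefel_square_orthogonal:
  assumes "A \<in> stiefel n n"
  shows "A \<in> orthogonal_matrices n"
  using stiefelD[OF assms] mat_mult_left_right_inverse[of "transpose_mat A" n A]
  by (simp add: orthogonal_matrices_def)

lemma orthonormal_completion:
  assumes S: "S \<in> stiefel p n" and "p \<le> n"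
  obtains T where "T \<in> stiefel (n - p) n" "transpose_mat S * T = 0\<^sub>m p (n - p)"
    "S @\<^sub>c T \<in> orthogonal_matrices n"
    "S * transpose_mat S + T * transpose_mat T = 1\<^sub>m n"
proof -
  obtain T where T: "T \<in> stiefel (n - p) n" "transpose_mat S * T = 0\<^sub>m p (n - p)"
    using orthonormal_complement[OF stiefelD(1)[OF S], of "n - p"] \<open>p \<le> n\<close> by auto
  have "S @\<^sub>c T \<in> orthogonal_matrices n"
    using stiefel_square_orthogonal stiefel_append_cols[OF S T] \<open>p \<le> n\<close> by simp
  moreover have "S * transpose_mat S + T * transpose_mat T = (S @\<^sub>c T) * transpose_mat (S @\<^sub>c T)"
    using append_cols_gram stiefelD(1)[OF S] stiefelD(1)[OF T(1)] by metis
  ultimately show ?thesis using that T by (simp add: orthogonal_matrices_def)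
qed

text \<open>
  Instead of orthonormalizing the columns of \<open>A\<close>, choose \<open>n - r\<close> orthonormal vectors \<open>T\<close> orthogonal to
  them and let \<open>W\<close> complete \<open>T\<close>. This yields exactly \<open>r\<close> columns whatever the rank of \<open>A\<close> is. A constant
  number of columns is what the compactness argument needs.
\<close>

lemma low_rank_projector:
  fixes A :: "real mat"
  assumes A: "A \<in> carrier_mat n m" and "vec_space.rank n A \<le> r" "r \<le> n"
  obtains W where "W \<in> stiefel r n" "W * transpose_mat W * A = A"
proof -
  let ?q = "vec_space.rank n A"
  obtain M D where M: "M \<in> carrier_mat n ?q" and D: "D \<in> carrier_mat ?q m" and MD: "A = M * D"
    using vec_space.rank_factorization[OF A] .
  have "n - r + ?q \<le> n" using assms by simp
  then obtain T where T: "T \<in> stiefel (n - r) n" and MT: "transpose_mat M * T = 0\<^sub>m ?q (n - r)"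
    using orthonormal_complement[OF M] by blast
  note Tc = stiefelD[OF T]
  obtain W where W: "W \<in> stiefel (n - (n - r)) n"
    and TW: "T * transpose_mat T + W * transpose_mat W = 1\<^sub>m n"
    using orthonormal_completion[OF T] by auto
  have W: "W \<in> stiefel r n" using W \<open>r \<le> n\<close> by simp
  note Wc = stiefelD[OF W]
  have "transpose_mat T * M = transpose_mat (transpose_mat M * T)"
    using M Tc by (simp add: transpose_mult[of _ ?q n])
  then have TM: "transpose_mat T * M = 0\<^sub>m (n - r) ?q" using MT by simp
  have "transpose_mat T * A = 0\<^sub>m (n - r) m"
    unfolding MD using assoc_mult_mat[OF Tc(2) M D] TM D by simp
  then have "T * transpose_mat T * A = 0\<^sub>m n m"
    using assoc_mult_mat[OF Tc(1,2) A] Tc by simp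
  then have "W * transpose_mat W * A = (T * transpose_mat T + W * transpose_mat W) * A"
    using add_mult_distrib_mat[of "T * transpose_mat T" n n "W * transpose_mat W" A m] Tc Wc A by simp
  then show ?thesis using that[OF W] TW A by simp
qed

lemma mult_transpose_eq_0_iff:
  fixes A :: "real mat"
  assumes A: "A \<in> carrier_mat n m" and 0: "A * transpose_mat A = 0\<^sub>m n n"
  shows "A = 0\<^sub>m n m"
proof (rule eq_matI)
  fix i j assume "i < dim_row (0\<^sub>m n m :: real mat)" "j < dim_col (0\<^sub>m n m :: real mat)"
  then have ij: "i < n" "j < m" by auto
  have "(A * transpose_mat A) $$ (i, i) = 0" using 0 ij by simp
  then have "(\<Sum>l<m. A $$ (i, l) * A $$ (i, l)) = 0"
    using A ij by (simp add: scalar_prod_def lessThan_atLeast0)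
  then have "A $$ (i, j) * A $$ (i, j) = 0"
    using ij by (subst (asm) sum_nonneg_eq_0_iff) auto
  then show "A $$ (i, j) = 0\<^sub>m n m $$ (i, j)" using ij by simp
qed (use A in auto)

text \<open>
  Were the Gram matrix \<open>B * B\<^sup>T\<close> singular, a projector \<open>W * W\<^sup>T\<close> of rank \<open>p - 1\<close> would fix it, hence
  fix \<open>B\<close>, and \<open>U * B = (U * W) * (W\<^sup>T * B)\<close> would have rank below \<open>p\<close>. So the Gram matrix is invertible
  and \<open>H\<close> is the usual pseudoinverse of \<open>B\<close>.
\<close>

lemma full_rank_right_inverse:
  fixes U B :: "real mat"
  assumes U: "U \<in> carrier_mat n p" and B: "B \<in> carrier_mat p m"
    and rank: "vec_space.rank n (U * B) = p"
  obtains H where "H \<in> carrier_mat m p" "B * H = 1\<^sub>m p"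
proof -
  let ?G = "B * transpose_mat B"
  have G: "?G \<in> carrier_mat p p" using B by simp
  have "det ?G \<noteq> 0"
  proof
    assume "det ?G = 0"
    then have low: "vec_space.rank p ?G \<le> p - 1" and "0 < p"
      using vec_space.det_zero_low_rank[OF G] by auto
    obtain W where W: "W \<in> stiefel (p - 1) p" and WG: "W * transpose_mat W * ?G = ?G"
      using low_rank_projector[OF G low] by auto
    note Wc = stiefelD[OF W]
    let ?P = "W * transpose_mat W"
    have P: "?P \<in> carrier_mat p p" using Wc by simp
    let ?D = "B - ?P * B"
    have D: "?D \<in> carrier_mat p m"
      using mult_carrier_mat[OF P B] by (rule minus_carrier_mat)
    have "?D * transpose_mat B = 0\<^sub>m p p"
      using minus_mult_distrib_mat[OF B, of "?P * B" "transpose_mat B" p] assoc_mult_mat[OF P B, of "transpose_mat B" p]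
        WG B P G by simp
    \<comment> \<open>\<open>?D * B\<^sup>T = 0\<close> gives \<open>?D * ?D\<^sup>T = 0\<close>, because \<open>?D\<^sup>T\<close> is \<open>B\<^sup>T\<close> times a matrix.\<close>
    moreover from this have "?D * (transpose_mat B * transpose_mat ?P) = 0\<^sub>m p p"
      using assoc_mult_mat[OF D, of "transpose_mat B" p "transpose_mat ?P" p] B P
        left_mult_zero_mat[of "transpose_mat ?P" p p p] by simp
    ultimately have "?D * transpose_mat ?D = 0\<^sub>m p p"
      using transpose_minus[of B p m "?P * B"] transpose_mult[OF P B] 
        mult_minus_distrib_mat[OF D, of "transpose_mat B" p "transpose_mat B * transpose_mat ?P"]
        B P by simp
    then have "?D = 0\<^sub>m p m" using mult_transpose_eq_0_iff[OF D] by simp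
    have "B = ?P * B"
    proof (rule eq_matI)
      fix i j assume "i < dim_row (?P * B)" "j < dim_col (?P * B)"
      then have ij: "i < p" "j < m" using P B by auto
      then have "?D $$ (i, j) = 0" using \<open>?D = 0\<^sub>m p m\<close> by simp
      moreover have "?D $$ (i, j) = B $$ (i, j) - (?P * B) $$ (i, j)"
        using ij mult_carrier_mat[OF P B] by (intro index_minus_mat) auto
      ultimately show "B $$ (i, j) = (?P * B) $$ (i, j)" by simp
    qed (use P B in auto)
    then have "U * B = U * (?P * B)" by (rule arg_cong)
    also have "\<dots> = U * (W * (transpose_mat W * B))"
      using assoc_mult_mat[OF Wc(1,2) B] by simp
    also have "\<dots> = (U * W) * (transpose_mat W * B)"
      using assoc_mult_mat[OF U Wc(1), of "transpose_mat W * B" m] Wc B by simp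
    finally have UB: "U * B = (U * W) * (transpose_mat W * B)" .
    have "vec_space.rank n (U * B) \<le> p - 1"
      unfolding UB using vec_space.rank_mult_le[of "U * W" n "p - 1" "transpose_mat W * B" m] U Wc B
      by (simp del: assoc_mult_mat)
    with rank \<open>0 < p\<close> show False by simp
  qed
  from det_non_zero_imp_unit[OF G this] obtain J where
    J: "J \<in> carrier_mat p p" "?G * J = 1\<^sub>m p"
    by (auto simp: Units_def ring_mat_def)
  show ?thesis
    using that[of "transpose_mat B * J"] J B assoc_mult_mat[OF B _ J(1), of "transpose_mat B"] by simp
qed

text \<open>
  The assumption \<open>W W\<^sup>T U = U\<close> says that the range of \<open>U\<close> lies in that of \<open>W\<close>, so \<open>U = W S\<close> where
  \<open>S = W\<^sup>T U\<close> has orthonormal columns. Completing \<open>S\<close> by \<open>T\<close> inside the coordinate space of \<open>W\<close> and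
  setting \<open>U1 = W T\<close> gives a basis of the range of \<open>W\<close> that begins with \<open>U\<close>; \<open>U2\<close> spans the orthogonal
  complement.
\<close>

lemma orthonormal_split:
  assumes W: "W \<in> stiefel r n" and U: "U \<in> stiefel p n" and "p \<le> r" "r \<le> n"
    and WU: "W * transpose_mat W * U = U"
  obtains U1 U2 where "U1 \<in> stiefel (r - p) n" "U2 \<in> stiefel (n - r) n"
    "U @\<^sub>c U1 @\<^sub>c U2 \<in> orthogonal_matrices n"
    "(U @\<^sub>c U1) * transpose_mat (U @\<^sub>c U1) = W * transpose_mat W"
    "W * transpose_mat W + U2 * transpose_mat U2 = 1\<^sub>m n"
proof -
  note Wc = stiefelD[OF W] and Uc = stiefelD[OF U]
  define S where "S = transpose_mat W * U"
  have Sc: "S \<in> carrier_mat r p" and Sc': "transpose_mat S \<in> carrier_mat p r"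
    using Wc Uc by (auto simp: S_def)
  have WS: "W * S = U"
    using WU assoc_mult_mat[OF Wc(1,2) Uc(1)] by (simp add: S_def)
  have UW: "transpose_mat S = transpose_mat U * W"
    using transpose_mult[OF Wc(2) Uc(1)] by (simp add: S_def)
  have "transpose_mat S * S = transpose_mat U * (W * S)"
    unfolding UW using assoc_mult_mat[OF Uc(2) Wc(1) Sc] .
  then have S: "S \<in> stiefel p r"
    using WS Uc(3) Sc by (simp add: stiefel_def)
  obtain T where T: "T \<in> stiefel (r - p) r" and ST: "transpose_mat S * T = 0\<^sub>m p (r - p)"
    and full: "S * transpose_mat S + T * transpose_mat T = 1\<^sub>m r"
    using orthonormal_completion[OF S \<open>p \<le> r\<close>] .
  note Tc = stiefelD[OF T]
  obtain U2 where U2: "U2 \<in> stiefel (n - r) n" and WU2: "transpose_mat W * U2 = 0\<^sub>m r (n - r)"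
    and full': "W * transpose_mat W + U2 * transpose_mat U2 = 1\<^sub>m n"
    using orthonormal_completion[OF W \<open>r \<le> n\<close>] .
  note U2c = stiefelD[OF U2]
  define U1 where "U1 = W * T"
  have U1c: "U1 \<in> carrier_mat n (r - p)" using Wc Tc by (simp add: U1_def)
  have U1t: "transpose_mat U1 = transpose_mat T * transpose_mat W"
    using transpose_mult[OF Wc(1) Tc(1)] by (simp add: U1_def)
  have Ut: "transpose_mat U = transpose_mat S * transpose_mat W"
    using transpose_mult[OF Wc(1) Sc] WS by simp
  have cancel: "transpose_mat W * (W * Z) = Z" if "Z \<in> carrier_mat r q" for Z q
    using assoc_mult_mat[OF Wc(2,1) that] Wc(3) that by simp
  have "transpose_mat U1 * U1 = transpose_mat T * (transpose_mat W * U1)"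
    unfolding U1t by (rule assoc_mult_mat[OF Tc(2) Wc(2) U1c])
  then have U1: "U1 \<in> stiefel (r - p) n"
    using cancel[OF Tc(1)] Tc(3) U1c by (simp add: stiefel_def U1_def)
  have "transpose_mat U * U1 = transpose_mat S * (transpose_mat W * U1)"
    unfolding Ut by (rule assoc_mult_mat[OF Sc' Wc(2) U1c])
  then have UU1: "transpose_mat U * U1 = 0\<^sub>m p (r - p)"
    using cancel[OF Tc(1)] ST by (simp add: U1_def)
  have "transpose_mat U * U2 = transpose_mat S * (transpose_mat W * U2)"
    unfolding Ut by (rule assoc_mult_mat[OF Sc' Wc(2) U2c(1)])
  then have UU2: "transpose_mat U * U2 = 0\<^sub>m p (n - r)"
    using right_mult_zero_mat[OF Sc'] WU2 by simp
  have "transpose_mat U1 * U2 = transpose_mat T * (transpose_mat W * U2)"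
    unfolding U1t by (rule assoc_mult_mat[OF Tc(2) Wc(2) U2c(1)])
  then have U1U2: "transpose_mat U1 * U2 = 0\<^sub>m (r - p) (n - r)"
    using right_mult_zero_mat[OF Tc(2)] WU2 by simp
  have U12: "U1 @\<^sub>c U2 \<in> stiefel ((r - p) + (n - r)) n"
    using stiefel_append_cols[OF U1 U2 U1U2] .
  have "transpose_mat U * (U1 @\<^sub>c U2) = 0\<^sub>m p ((r - p) + (n - r))"
    unfolding mult_append_cols[OF Uc(2) U1c U2c(1)] UU1 UU2
    by (intro eq_matI) (auto simp: append_cols_def)
  then have "U @\<^sub>c U1 @\<^sub>c U2 \<in> stiefel (p + ((r - p) + (n - r))) n"
    by (rule stiefel_append_cols[OF U U12])
  then have "U @\<^sub>c U1 @\<^sub>c U2 \<in> orthogonal_matrices n"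
    using \<open>p \<le> r\<close> \<open>r \<le> n\<close> by (intro stiefel_square_orthogonal) simp
  moreover have "(U @\<^sub>c U1) * transpose_mat (U @\<^sub>c U1) = W * transpose_mat W"
  proof -
    have "U @\<^sub>c U1 = W * (S @\<^sub>c T)"
      using mult_append_cols[OF Wc(1) Sc Tc(1)] WS by (simp add: U1_def)
    moreover have STc: "S @\<^sub>c T \<in> carrier_mat r (p + (r - p))"
      using append_cols_carrier[OF Sc Tc(1)] .
    moreover have "(S @\<^sub>c T) * (transpose_mat (S @\<^sub>c T) * transpose_mat W) = transpose_mat W"
      using assoc_mult_mat[OF STc _ Wc(2), of "transpose_mat (S @\<^sub>c T)"] STc
        append_cols_gram[OF Sc Tc(1) Sc Tc(1)] full Wc(2) by simp
    ultimately show ?thesis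
      using transpose_mult[OF Wc(1) STc]
        assoc_mult_mat[OF Wc(1) STc, of "transpose_mat (S @\<^sub>c T) * transpose_mat W" n] Wc(2) by simp
  qed
  ultimately show ?thesis using that U1 U2 full' by blast
qed

section \<open>Mode products\<close>

lemma in_tensors_iff:
  "X \<in> tensors ns \<longleftrightarrow>
    (\<forall>is. X is \<noteq> 0 \<longrightarrow> length is = length ns \<and> (\<forall>k<length ns. is ! k < ns ! k))"
  by (auto simp: tensors_def indices_def list_all2_conv_all_nth)

lemma mode_prod_commute:
  assumes "j \<noteq> k"
  shows "mode_prod (mode_prod X j A) k B = mode_prod (mode_prod X k B) j A"
proof
  fix "is"
  show "mode_prod (mode_prod X j A) k B is = mode_prod (mode_prod X k B) j A is"
  proof (cases "j < length is \<and> k < length is \<and> is ! j < dim_row A \<and> is ! k < dim_row B")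
    case True
    have "(\<Sum>b<dim_col B. B $$ (is ! k, b) * (\<Sum>a<dim_col A. A $$ (is ! j, a) * X (is[k := b, j := a]))) =
      (\<Sum>a<dim_col A. A $$ (is ! j, a) * (\<Sum>b<dim_col B. B $$ (is ! k, b) * X (is[j := a, k := b])))"
      by (simp add: sum_distrib_left mult.left_commute list_update_swap[OF \<open>j \<noteq> k\<close>])
        (subst sum.swap, rule refl)
    then show ?thesis using True assms by (simp add: mode_prod_def)
  next
    case False
    then show ?thesis using assms by (auto simp: mode_prod_def)
  qed
qed

lemma mode_prod_mode_prod:
  assumes "dim_col B = dim_row A"
  shows "mode_prod (mode_prod X k A) k B = mode_prod X k (B * A)"
proof
  fix "is"
  show "mode_prod (mode_prod X k A) k B is = mode_prod X k (B * A) is"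
  proof (cases "k < length is \<and> is ! k < dim_row B")
    case True
    have "(\<Sum>b<dim_col B. B $$ (is ! k, b) * (\<Sum>a<dim_col A. A $$ (b, a) * X (is[k := a]))) =
      (\<Sum>a<dim_col A. (\<Sum>b<dim_col B. B $$ (is ! k, b) * A $$ (b, a)) * X (is[k := a]))"
      by (simp add: sum_distrib_left sum_distrib_right mult.assoc)
        (subst sum.swap, rule refl)
    then show ?thesis
      using True assms by (simp add: mode_prod_def scalar_prod_def lessThan_atLeast0)
  next
    case False
    then show ?thesis by (auto simp: mode_prod_def)
  qed
qed

lemma mode_prod_add:
  "mode_prod (\<lambda>is. X is + Y is) k A = (\<lambda>is. mode_prod X k A is + mode_prod Y k A is)"
  by (auto simp: mode_prod_def fun_eq_iff distrib_left sum.distrib)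

lemma mode_prod_scale:
  "mode_prod (\<lambda>is. c * X is) k A = (\<lambda>is. c * mode_prod X k A is)"
  by (auto simp: mode_prod_def fun_eq_iff sum_distrib_left mult.left_commute)

lemma mode_prod_sum:
  "mode_prod (\<lambda>is. \<Sum>x\<in>I. f x is) k A = (\<lambda>is. \<Sum>x\<in>I. mode_prod (f x) k A is)"
proof
  fix "is"
  have "(\<Sum>j<dim_col A. A $$ (is ! k, j) * (\<Sum>x\<in>I. f x (is[k := j]))) =
      (\<Sum>x\<in>I. \<Sum>j<dim_col A. A $$ (is ! k, j) * f x (is[k := j]))"
    unfolding sum_distrib_left by (rule sum.swap)
  then show "mode_prod (\<lambda>is. \<Sum>x\<in>I. f x is) k A is = (\<Sum>x\<in>I. mode_prod (f x) k A is)"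
    by (cases "k < length is \<and> is ! k < dim_row A") (auto simp: mode_prod_def)
qed

lemma mode_prod_add_mat:
  assumes "A \<in> carrier_mat p q" "B \<in> carrier_mat p q"
  shows "mode_prod X k (A + B) = (\<lambda>is. mode_prod X k A is + mode_prod X k B is)"
  using assms by (auto simp: mode_prod_def fun_eq_iff distrib_right sum.distrib)

lemma mode_prod_one:
  assumes "X \<in> tensors ns" "k < length ns"
  shows "mode_prod X k (1\<^sub>m (ns ! k)) = X"
proof
  fix "is"
  show "mode_prod X k (1\<^sub>m (ns ! k)) is = X is"
  proof (cases "k < length is \<and> is ! k < ns ! k")
    case True
    then have "(\<Sum>j<ns ! k. 1\<^sub>m (ns ! k) $$ (is ! k, j) * X (is[k := j])) =
      (\<Sum>j<ns ! k. if j = is ! k then X is else 0)"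
      by (intro sum.cong) auto
    then show ?thesis using True by (simp add: mode_prod_def)
  next
    case False
    then show ?thesis using assms by (auto simp: mode_prod_def in_tensors_iff)
  qed
qed

text \<open>
  This is the matrix form of padding a core with zeros: columns beyond the size of \<open>G\<close> in mode \<open>k\<close> only
  meet zero entries.
\<close>

lemma mode_prod_append_cols:
  assumes "G \<in> tensors ms" "k < length ms" "A \<in> carrier_mat n (ms ! k)" "B \<in> carrier_mat n q"
  shows "mode_prod G k (A @\<^sub>c B) = mode_prod G k A"
proof
  fix "is"
  show "mode_prod G k (A @\<^sub>c B) is = mode_prod G k A is"
  proof (cases "k < length is \<and> is ! k < n")
    case True
    have "G (is[k := j]) = 0" if "\<not> j < ms ! k" for j
    proof (rule ccontr)
      assume "G (is[k := j]) \<noteq> 0"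
      then have "is[k := j] ! k < ms ! k" using assms(1,2) by (simp add: in_tensors_iff)
      then show False using True that by simp
    qed
    then have "(\<Sum>j<ms ! k + q. (A @\<^sub>c B) $$ (is ! k, j) * G (is[k := j])) =
        (\<Sum>j<ms ! k. A $$ (is ! k, j) * G (is[k := j]))"
      using True assms by (intro sum.mono_neutral_cong_right) (auto simp: index_append_cols)
    then show ?thesis using True assms by (simp add: mode_prod_def append_cols_def)
  next
    case False
    then show ?thesis using assms by (auto simp: mode_prod_def append_cols_def)
  qed
qed

lemma mode_prods_Nil [simp]: "mode_prods [] X A = X"
  and mode_prods_Cons [simp]: "mode_prods (k # ks) X A = mode_prods ks (mode_prod X k (A k)) A"
  and mode_prods_snoc: "mode_prods (ks @ [k]) X A = mode_prod (mode_prods ks X A) k (A k)"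
  by (simp_all add: mode_prods_def)

lemma mode_prods_mode_prod:
  assumes "k \<notin> set ks"
  shows "mode_prods ks (mode_prod X k B) A = mode_prod (mode_prods ks X A) k B"
  using assms by (induction ks arbitrary: X) (simp_all add: mode_prod_commute[of k])

lemma mode_prods_isolate:
  assumes "distinct ks" "k \<in> set ks"
  shows "mode_prods ks X A = mode_prod (mode_prods [j \<leftarrow> ks. j \<noteq> k] X A) k (A k)"
  using assms
proof (induction ks arbitrary: X)
  case (Cons a ks)
  show ?case
  proof (cases "a = k")
    case True
    then have "[j \<leftarrow> a # ks. j \<noteq> k] = ks" using Cons.prems by (auto intro: filter_True)
    then show ?thesis using True Cons.prems by (simp add: mode_prods_mode_prod)
  next
    case False
    then show ?thesis using Cons by auto
  qed
qed simp

lemma mode_prods_isolate':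
  assumes "distinct ks" "k \<in> set ks"
  shows "mode_prods ks X A = mode_prods [j \<leftarrow> ks. j \<noteq> k] (mode_prod X k (A k)) A"
  unfolding mode_prods_isolate[OF assms] by (rule mode_prods_mode_prod[symmetric]) simp

lemma mode_prods_cong:
  assumes "\<And>k. k \<in> set ks \<Longrightarrow> A k = B k"
  shows "mode_prods ks X A = mode_prods ks X B"
  using assms by (induction ks arbitrary: X) simp_all

text \<open>
  Factors of different modes commute, so each factor may be moved next to the core and exchanged there.
  In this way a fact about a single mode product of the core carries over to the full product.
\<close>

lemma mode_prods_cong_core:
  assumes "distinct ks" "\<And>k. k \<in> set ks \<Longrightarrow> mode_prod X k (A k) = mode_prod X k (B k)"
  shows "mode_prods ks X A = mode_prods ks X B"
  using assms
proof (induction ks rule: rev_induct)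
  case (snoc k ks)
  have "mode_prods (ks @ [k]) X A = mode_prods ks (mode_prod X k (A k)) A"
    using snoc.prems(1) by (simp add: mode_prods_snoc mode_prods_mode_prod)
  also have "\<dots> = mode_prods ks (mode_prod X k (B k)) A" using snoc.prems by simp
  also have "\<dots> = mode_prod (mode_prods ks X A) k (B k)"
    using snoc.prems(1) by (simp add: mode_prods_mode_prod)
  also have "\<dots> = mode_prods (ks @ [k]) X B"
    using snoc by (simp add: mode_prods_snoc)
  finally show ?case .
qed simp

lemma mode_prods_mode_prods:
  assumes "distinct ks" "\<And>k. k \<in> set ks \<Longrightarrow> dim_col (B k) = dim_row (A k)"
  shows "mode_prods ks (mode_prods ks X A) B = mode_prods ks X (\<lambda>k. B k * A k)"
  using assms
proof (induction ks arbitrary: X)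
  case (Cons k ks)
  then show ?case
    by (simp add: mode_prods_mode_prod[symmetric] mode_prod_mode_prod)
qed simp

lemma mode_prods_add:
  "mode_prods ks (\<lambda>is. X is + Y is) A = (\<lambda>is. mode_prods ks X A is + mode_prods ks Y A is)"
  by (induction ks arbitrary: X Y) (simp_all add: mode_prod_add)

lemma mode_prod_length:
  assumes "\<And>is. X is \<noteq> 0 \<Longrightarrow> length is = d" "mode_prod X k A is \<noteq> 0"
  shows "length is = d"
proof -
  from assms(2) have "(\<Sum>j<dim_col A. A $$ (is ! k, j) * X (is[k := j])) \<noteq> 0"
    by (auto simp: mode_prod_def split: if_splits)
  then obtain j where "A $$ (is ! k, j) * X (is[k := j]) \<noteq> 0"
    by (meson sum.neutral)
  then show ?thesis using assms(1)[of "is[k := j]"] by simp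
qed

lemma mode_prods_length:
  assumes "\<And>is. X is \<noteq> 0 \<Longrightarrow> length is = d" "mode_prods ks X A is \<noteq> 0"
  shows "length is = d"
  using assms
proof (induction ks arbitrary: X)
  case (Cons k ks)
  from Cons.prems(2) show ?case
    using Cons.IH[of "mode_prod X k (A k)"] mode_prod_length[OF Cons.prems(1)] by auto
qed simp

text \<open>
  Every mode can be made the outermost one, and the outermost product bounds its index.
\<close>

lemma mode_prods_in_tensors:
  assumes X: "X \<in> tensors ms" and len: "length ms = length ns"
    and A: "\<And>k. k < length ns \<Longrightarrow> dim_row (A k) = ns ! k"
  shows "mode_prods [0..<length ns] X A \<in> tensors ns"
  unfolding in_tensors_iff
proof (intro allI impI conjI)
  fix "is" assume nz: "mode_prods [0..<length ns] X A is \<noteq> 0"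
  show "length is = length ns"
    using mode_prods_length[OF _ nz] X len by (auto simp: in_tensors_iff)
  fix k assume k: "k < length ns"
  have "mode_prod (mode_prods [j \<leftarrow> [0..<length ns]. j \<noteq> k] X A) k (A k) is \<noteq> 0"
    using nz mode_prods_isolate[of "[0..<length ns]" k X A] k by simp
  then show "is ! k < ns ! k" using A[OF k] by (auto simp: mode_prod_def split: if_splits)
qed

lemma unfold_mode_carrier:
  "unfold_mode ns k X \<in> carrier_mat (ns ! k) (length (unfolding_cols ns k))"
  by (simp add: unfold_mode_def)

text \<open>
  Unlike \<open>unfold_mode_prod\<close>, this starts from the size \<open>ns\<close> of the result: a Tucker product has a fixed
  size, and its core with the factors of the other modes has size \<open>m\<close> in mode \<open>k\<close>.
\<close>

lemma unfold_mode_mode_prod: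
  assumes k: "k < length ns" and A: "A \<in> carrier_mat (ns ! k) m"
  shows "unfold_mode ns k (mode_prod X k A) = A * unfold_mode (ns[k := m]) k X"
  using unfold_mode_prod[of k "ns[k := m]" A "ns ! k" X] assms by simp

lemma unfold_mode_scale: "unfold_mode ns k (\<lambda>is. c * X is) = c \<cdot>\<^sub>m unfold_mode ns k X"
  by (intro eq_matI) (auto simp: unfold_mode_def)

lemma mode_prod_square_in_tensors:
  assumes "X \<in> tensors ns" "k < length ns" "A \<in> carrier_mat (ns ! k) (ns ! k)"
  shows "mode_prod X k A \<in> tensors ns"
  using mode_prod_in_tensors[OF assms] by simp

lemma mode_prod_add_complement:
  assumes X: "X \<in> tensors ns" and k: "k < length ns" and P: "P \<in> carrier_mat (ns ! k) (ns ! k)"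
  shows "mode_prod X k P is + mode_prod X k (1\<^sub>m (ns ! k) - P) is = X is"
proof -
  have "P + (1\<^sub>m (ns ! k) - P) = 1\<^sub>m (ns ! k)"
    using P by (intro eq_matI) auto
  then show ?thesis
    using mode_prod_add_mat[of P "ns ! k" "ns ! k" "1\<^sub>m (ns ! k) - P" X k] mode_prod_one[OF X k] P
    by (metis minus_carrier_mat)
qed

text \<open>
  With the factor \<open>W k\<close> moved to the outside, the mode-\<open>k\<close> unfolding is \<open>W k\<close> times another matrix, and
  \<open>W k\<close> has only \<open>rs ! k\<close> columns.
\<close>

lemma mode_prods_in_tucker_variety:
  assumes F: "F \<in> tensors rs" and len: "length rs = length ns"
    and W: "\<And>k. k < length ns \<Longrightarrow> W k \<in> carrier_mat (ns ! k) (rs ! k)"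
  shows "mode_prods [0..<length ns] F W \<in> tucker_variety ns rs"
proof -
  let ?Y = "mode_prods [0..<length ns] F W"
  have "?Y \<in> tensors ns" using mode_prods_in_tensors[OF F len] W by blast
  moreover have "vec_space.rank (ns ! k) (unfold_mode ns k ?Y) \<le> rs ! k" if k: "k < length ns" for k
  proof -
    have "?Y = mode_prod (mode_prods [j \<leftarrow> [0..<length ns]. j \<noteq> k] F W) k (W k)"
      using k by (intro mode_prods_isolate) auto
    then have Y: "unfold_mode ns k ?Y =
        W k * unfold_mode (ns[k := rs ! k]) k (mode_prods [j \<leftarrow> [0..<length ns]. j \<noteq> k] F W)"
      using unfold_mode_mode_prod[OF k W[OF k]] by simp
    show ?thesis
      unfolding Y using unfold_mode_carrier[of "ns[k := rs ! k]" k] k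
      by (intro vec_space.rank_mult_le[OF W[OF k]]) simp
  qed
  ultimately show ?thesis
    using len by (auto simp: tucker_variety_def tucker_rank_def list_all2_conv_all_nth)
qed

section \<open>Differentiating mode products\<close>

lemma mode_prod_tendsto:
  assumes X: "\<And>is. ((\<lambda>m. X m is) \<longlongrightarrow> X0 is) F"
    and A: "\<And>m. A m \<in> carrier_mat p q" "A0 \<in> carrier_mat p q"
    and lim: "\<And>i j. i < p \<Longrightarrow> j < q \<Longrightarrow> ((\<lambda>m. A m $$ (i, j)) \<longlongrightarrow> A0 $$ (i, j)) F"
  shows "((\<lambda>m. mode_prod (X m) k (A m) is) \<longlongrightarrow> mode_prod X0 k A0 is) F"
proof (cases "k < length is \<and> is ! k < p")
  case True
  note dims = A[THEN carrier_matD(1)] A[THEN carrier_matD(2)]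
  have "((\<lambda>m. \<Sum>j<q. A m $$ (is ! k, j) * X m (is[k := j])) \<longlongrightarrow>
      (\<Sum>j<q. A0 $$ (is ! k, j) * X0 (is[k := j]))) F"
    using True X lim by (intro tendsto_sum tendsto_mult) auto
  then show ?thesis using True by (simp add: mode_prod_def dims)
next
  case False
  then have "mode_prod (X m) k (A m) is = 0" "mode_prod X0 k A0 is = 0" for m
    using A[THEN carrier_matD(1)] by (auto simp: mode_prod_def)
  then show ?thesis by simp
qed

lemma mode_prod_derivative:
  assumes X: "\<And>is. ((\<lambda>m. (X m is - X0 is) / t m) \<longlongrightarrow> X' is) F"
    and A: "\<And>m. A m \<in> carrier_mat p q" "A0 \<in> carrier_mat p q" "A' \<in> carrier_mat p q"
    and lim: "\<And>i j. i < p \<Longrightarrow> j < q \<Longrightarrow> ((\<lambda>m. A m $$ (i, j)) \<longlongrightarrow> A0 $$ (i, j)) F"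
    and der: "\<And>i j. i < p \<Longrightarrow> j < q \<Longrightarrow>
      ((\<lambda>m. (A m $$ (i, j) - A0 $$ (i, j)) / t m) \<longlongrightarrow> A' $$ (i, j)) F"
  shows "((\<lambda>m. (mode_prod (X m) k (A m) is - mode_prod X0 k A0 is) / t m) \<longlongrightarrow>
    mode_prod X' k A0 is + mode_prod X0 k A' is) F"
proof (cases "k < length is \<and> is ! k < p")
  case True
  note dims = A[THEN carrier_matD(1)] A[THEN carrier_matD(2)]
  have "((\<lambda>m. \<Sum>j<q. A m $$ (is ! k, j) * ((X m (is[k := j]) - X0 (is[k := j])) / t m) +
        (A m $$ (is ! k, j) - A0 $$ (is ! k, j)) / t m * X0 (is[k := j])) \<longlongrightarrow>
      (\<Sum>j<q. A0 $$ (is ! k, j) * X' (is[k := j]) + A' $$ (is ! k, j) * X0 (is[k := j]))) F"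
    using True X lim der by (intro tendsto_sum tendsto_add tendsto_mult tendsto_const) auto
  moreover have "A m $$ (is ! k, j) * ((X m (is[k := j]) - X0 (is[k := j])) / t m) +
        (A m $$ (is ! k, j) - A0 $$ (is ! k, j)) / t m * X0 (is[k := j]) =
      (A m $$ (is ! k, j) * X m (is[k := j]) - A0 $$ (is ! k, j) * X0 (is[k := j])) / t m" for m j
    by (simp add: field_simps diff_divide_distrib[symmetric] add_divide_distrib[symmetric])
  ultimately have "((\<lambda>m. \<Sum>j<q. (A m $$ (is ! k, j) * X m (is[k := j]) -
        A0 $$ (is ! k, j) * X0 (is[k := j])) / t m) \<longlongrightarrow>
      (\<Sum>j<q. A0 $$ (is ! k, j) * X' (is[k := j]) + A' $$ (is ! k, j) * X0 (is[k := j]))) F"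
    by (simp only:)
  then show ?thesis
    using True by (simp add: mode_prod_def dims sum.distrib sum_subtractf sum_divide_distrib[symmetric])
next
  case False
  then have "mode_prod (X m) k (A m) is = 0" "mode_prod X0 k A0 is = 0" "mode_prod X' k A0 is = 0"
    "mode_prod X0 k A' is = 0" for m
    using A[THEN carrier_matD(1)] by (auto simp: mode_prod_def)
  then show ?thesis by simp
qed

text \<open>
  Difference quotients along an arbitrary filter are used instead of derivatives, since the tangent cone
  is defined by sequences. In the induction the accumulated product takes the place of the core; the
  new summand, where the last factor is differentiated, is brought to the stated form by moving that
  factor next to the core.
\<close>

lemma mode_prods_derivative:
  assumes "distinct ks"
    and X: "\<And>is. ((\<lambda>m. (X m is - X0 is) / t m) \<longlongrightarrow> X' is) F"
    and A: "\<And>k m. k \<in> set ks \<Longrightarrow> A m k \<in> carrier_mat (p k) (q k)"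
      "\<And>k. k \<in> set ks \<Longrightarrow> A0 k \<in> carrier_mat (p k) (q k)"
      "\<And>k. k \<in> set ks \<Longrightarrow> A' k \<in> carrier_mat (p k) (q k)"
    and lim: "\<And>k i j. k \<in> set ks \<Longrightarrow> i < p k \<Longrightarrow> j < q k \<Longrightarrow>
      ((\<lambda>m. A m k $$ (i, j)) \<longlongrightarrow> A0 k $$ (i, j)) F"
    and der: "\<And>k i j. k \<in> set ks \<Longrightarrow> i < p k \<Longrightarrow> j < q k \<Longrightarrow>
      ((\<lambda>m. (A m k $$ (i, j) - A0 k $$ (i, j)) / t m) \<longlongrightarrow> A' k $$ (i, j)) F"
  shows "((\<lambda>m. (mode_prods ks (X m) (A m) is - mode_prods ks X0 A0 is) / t m) \<longlongrightarrow>
    mode_prods ks X' A0 is +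
    (\<Sum>k\<in>set ks. mode_prods [j \<leftarrow> ks. j \<noteq> k] (mode_prod X0 k (A' k)) A0 is)) F"
  using assms
proof (induction ks arbitrary: "is" rule: rev_induct)
  case Nil
  then show ?case by simp
next
  case (snoc k ks)
  define D where "D = (\<lambda>is. mode_prods ks X' A0 is +
    (\<Sum>l\<in>set ks. mode_prods [j \<leftarrow> ks. j \<noteq> l] (mode_prod X0 l (A' l)) A0 is))"
  have k: "k \<notin> set ks" and dist: "distinct ks" using snoc.prems(1) by auto
  have "((\<lambda>m. (mode_prods ks (X m) (A m) is - mode_prods ks X0 A0 is) / t m) \<longlongrightarrow> D is) F" for "is"
    unfolding D_def by (rule snoc.IH[OF dist]) (use snoc.prems in auto)
  then have "((\<lambda>m. (mode_prods (ks @ [k]) (X m) (A m) is - mode_prods (ks @ [k]) X0 A0 is) / t m) \<longlongrightarrow>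
    mode_prod D k (A0 k) is + mode_prod (mode_prods ks X0 A0) k (A' k) is) F"
    unfolding mode_prods_snoc by (rule mode_prod_derivative) (use snoc.prems in auto)
  moreover have "mode_prod D k (A0 k) = (\<lambda>is. mode_prods (ks @ [k]) X' A0 is +
    (\<Sum>l\<in>set ks. mode_prods [j \<leftarrow> ks @ [k]. j \<noteq> l] (mode_prod X0 l (A' l)) A0 is))"
    using k unfolding D_def mode_prod_add mode_prod_sum
    by (intro ext arg_cong2[of _ _ _ _ "(+)"] sum.cong) (auto simp: mode_prods_snoc)
  moreover have "[j \<leftarrow> ks @ [k]. j \<noteq> k] = ks" using k by (auto intro: filter_True)
  then have "mode_prod (mode_prods ks X0 A0) k (A' k) =
      mode_prods [j \<leftarrow> ks @ [k]. j \<noteq> k] (mode_prod X0 k (A' k)) A0"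
    using k by (simp add: mode_prods_mode_prod)
  ultimately show ?case using k by (simp add: ac_simps)
qed

section \<open>Compactness of matrices with orthonormal columns\<close>

lemma fun_tendsto_iff:
  fixes f :: "'b \<Rightarrow> 'a \<Rightarrow> 'c :: topological_space"
  shows "(f \<longlongrightarrow> l) F \<longleftrightarrow> (\<forall>x. ((\<lambda>m. f m x) \<longlongrightarrow> l x) F)"
  using limitin_componentwise[of "\<lambda>_. euclidean" UNIV f l F]
  by (simp add: euclidean_product_topology)

lemma common_convergent_subsequence:
  fixes f :: "'i \<Rightarrow> nat \<Rightarrow> real"
  assumes "finite I" "\<And>i m. i \<in> I \<Longrightarrow> \<bar>f i m\<bar> \<le> B"
  obtains s :: "nat \<Rightarrow> nat" where "strict_mono s" "\<And>i. i \<in> I \<Longrightarrow> convergent (\<lambda>m. f i (s m))"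
  using assms
proof (induction I arbitrary: thesis rule: finite_induct)
  case empty
  show ?case by (rule empty.prems(1)[of id]) (simp_all add: strict_mono_def)
next
  case (insert x I)
  from insert.IH insert.prems(2) obtain s :: "nat \<Rightarrow> nat"
    where s: "strict_mono s" "\<And>i. i \<in> I \<Longrightarrow> convergent (\<lambda>m. f i (s m))" by blast
  obtain s' :: "nat \<Rightarrow> nat" where s': "strict_mono s'" "monoseq (\<lambda>m. f x (s (s' m)))"
    using seq_monosub[of "\<lambda>m. f x (s m)"] by blast
  have "Bseq (\<lambda>m. f x (s (s' m)))"
    using insert.prems(2)[of x] by (intro BseqI'[of _ B]) simp
  then have "convergent (\<lambda>m. f x (s (s' m)))" using s'(2) by (rule Bseq_monoseq_convergent)
  moreover have "convergent (\<lambda>m. f i (s (s' m)))" if "i \<in> I" for i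
    using convergent_subseq_convergent[OF s(2)[OF that] s'(1)] by (simp add: o_def)
  moreover have "strict_mono (\<lambda>m. s (s' m))"
    using strict_mono_o[OF s(1) s'(1)] by (simp add: o_def)
  ultimately show ?case by (intro insert.prems(1)[of "\<lambda>m. s (s' m)"]) auto
qed

lemma mult_mat_tendsto:
  fixes A B :: "'b \<Rightarrow> real mat"
  assumes "\<And>m. A m \<in> carrier_mat n p" "A0 \<in> carrier_mat n p"
    and "\<And>m. B m \<in> carrier_mat p q" "B0 \<in> carrier_mat p q"
    and "\<And>i j. i < n \<Longrightarrow> j < p \<Longrightarrow> ((\<lambda>m. A m $$ (i, j)) \<longlongrightarrow> A0 $$ (i, j)) F"
    and "\<And>i j. i < p \<Longrightarrow> j < q \<Longrightarrow> ((\<lambda>m. B m $$ (i, j)) \<longlongrightarrow> B0 $$ (i, j)) F"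
    and "i < n" "j < q"
  shows "((\<lambda>m. (A m * B m) $$ (i, j)) \<longlongrightarrow> (A0 * B0) $$ (i, j)) F"
  unfolding index_mult_mat_sum[OF assms(1,3,7,8)] index_mult_mat_sum[OF assms(2,4,7,8)]
  using assms by (intro tendsto_sum tendsto_mult) auto

lemma stiefel_entry_bound:
  assumes A: "A \<in> stiefel p n" and ij: "i < n" "j < p"
  shows "\<bar>A $$ (i, j)\<bar> \<le> 1"
proof -
  note Ac = stiefelD[OF A]
  have "(transpose_mat A * A) $$ (j, j) = 1" using Ac(3) ij by simp
  then have "(\<Sum>l<n. A $$ (l, j) * A $$ (l, j)) = 1"
    using index_mult_mat_sum[OF Ac(2,1) ij(2,2)] Ac(1) ij by simp
  moreover have "A $$ (i, j) * A $$ (i, j) \<le> (\<Sum>l<n. A $$ (l, j) * A $$ (l, j))"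
    using ij by (intro member_le_sum) auto
  ultimately have "(A $$ (i, j))\<^sup>2 \<le> 1" by (simp add: power2_eq_square)
  then show ?thesis by (simp add: abs_square_le_1)
qed

lemma stiefel_limit:
  assumes A: "\<And>m. A m \<in> stiefel p n" and A0: "A0 \<in> carrier_mat n p"
    and lim: "\<And>i j. i < n \<Longrightarrow> j < p \<Longrightarrow> (\<lambda>m. A m $$ (i, j)) \<longlonglongrightarrow> A0 $$ (i, j)"
  shows "A0 \<in> stiefel p n"
proof -
  have "transpose_mat A0 * A0 = 1\<^sub>m p"
  proof (rule eq_matI)
    fix i j assume "i < dim_row (1\<^sub>m p :: real mat)" "j < dim_col (1\<^sub>m p :: real mat)"
    then have ij: "i < p" "j < p" by auto
    have "(\<lambda>m. (transpose_mat (A m) * A m) $$ (i, j)) \<longlonglongrightarrow> (transpose_mat A0 * A0) $$ (i, j)"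
      by (rule mult_mat_tendsto[of _ p n _ _ p])
        (use A0 ij lim in \<open>auto simp: stiefelD(1)[OF A] carrier_matD[OF stiefelD(1)[OF A]]\<close>)
    then have "(\<lambda>m. 1\<^sub>m p $$ (i, j) :: real) \<longlonglongrightarrow> (transpose_mat A0 * A0) $$ (i, j)"
      by (simp only: stiefelD(3)[OF A])
    then show "(transpose_mat A0 * A0) $$ (i, j) = 1\<^sub>m p $$ (i, j)"
      by (simp only: LIMSEQ_const_iff)
  qed (use A0 in auto)
  then show ?thesis using A0 by (simp add: stiefel_def)
qed

text \<open>
  One subsequence serves all modes. Each mode has its own matrix size, so the entries of all the
  matrices are collected in one finite index set.
\<close>

lemma stiefel_convergent_subsequence:
  fixes W :: "nat \<Rightarrow> nat \<Rightarrow> real mat"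
  assumes W: "\<And>m k. k < d \<Longrightarrow> W m k \<in> stiefel (r k) (n k)"
  obtains s W0 where "strict_mono (s :: nat \<Rightarrow> nat)" "\<And>k. k < d \<Longrightarrow> W0 k \<in> stiefel (r k) (n k)"
    "\<And>k i j. k < d \<Longrightarrow> i < n k \<Longrightarrow> j < r k \<Longrightarrow> (\<lambda>m. W (s m) k $$ (i, j)) \<longlonglongrightarrow> W0 k $$ (i, j)"
proof -
  define I where "I = (SIGMA k:{..<d}. {..<n k} \<times> {..<r k})"
  have "finite I" unfolding I_def by (intro finite_SigmaI) auto
  moreover have "\<bar>(\<lambda>(k, ij). W m k $$ ij) x\<bar> \<le> 1" if "x \<in> I" for x m
    using that stiefel_entry_bound[OF W] by (auto simp: I_def)
  ultimately obtain s :: "nat \<Rightarrow> nat" where s: "strict_mono s"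
    and conv: "\<And>x. x \<in> I \<Longrightarrow> convergent (\<lambda>m. (\<lambda>(k, ij). W (s m) k $$ ij) x)"
    using common_convergent_subsequence[of I "\<lambda>x m. (\<lambda>(k, ij). W m k $$ ij) x" 1] by blast
  define W0 where "W0 k = mat (n k) (r k) (\<lambda>ij. lim (\<lambda>m. W (s m) k $$ ij))" for k
  have lim: "(\<lambda>m. W (s m) k $$ (i, j)) \<longlonglongrightarrow> W0 k $$ (i, j)" if "k < d" "i < n k" "j < r k" for k i j
    using conv[of "(k, i, j)"] that by (simp add: I_def W0_def convergent_LIMSEQ_iff)
  have "W0 k \<in> stiefel (r k) (n k)" if "k < d" for k
    by (rule stiefel_limit[of "\<lambda>m. W (s m) k"]) (use W lim that in \<open>auto simp: W0_def\<close>)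
  then show ?thesis using that s lim by blast
qed

section \<open>Tucker curves and their velocities\<close>

lemma tensors_mono:
  assumes "G \<in> tensors rs'" "length rs' = length rs" "\<And>k. k < length rs \<Longrightarrow> rs' ! k \<le> rs ! k"
  shows "G \<in> tensors rs"
  using assms unfolding in_tensors_iff by (metis order_less_le_trans)

text \<open>
  The velocity at \<open>0\<close> of \<open>t \<mapsto> (G + t C) \<times>\<^sub>k [U\<^sub>k + t Z\<^sub>k, U\<^sub>k\<^sub>,\<^sub>1]\<close>, evaluated along \<open>t = 1 / (m + 1)\<close>.
  Differentiating the core produces the term with \<open>C\<close>; in the terms where a factor is differentiated
  the core is \<open>G\<close>, and its zero padding removes the columns \<open>U\<^sub>k\<^sub>,\<^sub>1\<close>.
\<close>

lemma tucker_curve_tangent: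
  fixes ns rs rs' :: "nat list"
  defines "d \<equiv> length ns"
  assumes len: "length rs = d" "length rs' = d" and le: "\<And>k. k < d \<Longrightarrow> rs' ! k \<le> rs ! k"
    and G: "G \<in> tensors rs'" and C: "C \<in> tensors rs"
    and U: "\<And>k. k < d \<Longrightarrow> U k \<in> carrier_mat (ns ! k) (rs' ! k)"
    and U1: "\<And>k. k < d \<Longrightarrow> U1 k \<in> carrier_mat (ns ! k) (rs ! k - rs' ! k)"
    and Z: "\<And>k. k < d \<Longrightarrow> Z k \<in> carrier_mat (ns ! k) (rs' ! k)"
  shows "(\<lambda>is. mode_prods [0..<d] C (\<lambda>k. U k @\<^sub>c U1 k) is +
      (\<Sum>k<d. mode_prods [j \<leftarrow> [0..<d]. j \<noteq> k] (mode_prod G k (Z k)) U is))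
    \<in> tangent_cone (tucker_variety ns rs) (mode_prods [0..<d] G U)"
    (is "?V \<in> tangent_cone _ ?X")
proof -
  define t :: "nat \<Rightarrow> real" where "t m = inverse (real (Suc m))" for m
  define A0 where "A0 k = U k @\<^sub>c U1 k" for k
  define A' where "A' k = Z k @\<^sub>c 0\<^sub>m (ns ! k) (rs ! k - rs' ! k)" for k
  define A where "A m k = A0 k + t m \<cdot>\<^sub>m A' k" for m k
  define F where "F m = (\<lambda>is. G is + t m * C is)" for m
  define Y where "Y m = mode_prods [0..<d] (F m) (A m)" for m
  have t: "0 < t m" for m by (simp add: t_def)
  have t0: "t \<longlonglongrightarrow> 0" unfolding t_def by (rule LIMSEQ_inverse_real_of_nat)
  have A0: "A0 k \<in> carrier_mat (ns ! k) (rs ! k)" if "k < d" for k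
    using append_cols_carrier[OF U[OF that] U1[OF that]] le[OF that] by (simp add: A0_def)
  have A': "A' k \<in> carrier_mat (ns ! k) (rs ! k)" if "k < d" for k
    using append_cols_carrier[OF Z[OF that] zero_carrier_mat[of _ "rs ! k - rs' ! k"]] le[OF that]
    by (simp add: A'_def)
  have A: "A m k \<in> carrier_mat (ns ! k) (rs ! k)" if "k < d" for m k
    using A0[OF that] A'[OF that] by (simp add: A_def)
  have Aij: "A m k $$ (i, j) = A0 k $$ (i, j) + t m * A' k $$ (i, j)"
    if "k < d" "i < ns ! k" "j < rs ! k" for m k i j
    using A0 A' that by (simp add: A_def carrier_matD[OF A0] carrier_matD[OF A'])
  have GA0: "mode_prod G k (A0 k) = mode_prod G k (U k)" if "k < d" for k
    unfolding A0_def using G len U[OF that] U1[OF that] that by (intro mode_prod_append_cols) auto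
  have GA': "mode_prod G k (A' k) = mode_prod G k (Z k)" if "k < d" for k
    unfolding A'_def using G len Z[OF that] that by (intro mode_prod_append_cols) auto
  have X: "mode_prods [0..<d] G A0 = ?X"
    using GA0 by (intro mode_prods_cong_core) auto
  have "F m \<in> tensors rs" for m
    using C tensors_mono[OF G] len le by (auto simp: F_def tensors_def)
  then have "Y m \<in> tucker_variety ns rs" for m
    unfolding Y_def d_def using A len by (intro mode_prods_in_tucker_variety) (auto simp: d_def)
  moreover have quot: "(\<lambda>m. (Y m is - ?X is) / t m) \<longlonglongrightarrow> ?V is" for "is"
  proof -
    have "(\<lambda>m. (mode_prods [0..<d] (F m) (A m) is - mode_prods [0..<d] G A0 is) / t m) \<longlonglongrightarrow>
      mode_prods [0..<d] C A0 is +
      (\<Sum>k\<in>set [0..<d]. mode_prods [j \<leftarrow> [0..<d]. j \<noteq> k] (mode_prod G k (A' k)) A0 is)"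
    proof (rule mode_prods_derivative)
      show "(\<lambda>m. (F m is - G is) / t m) \<longlonglongrightarrow> C is" for "is"
        using t by (simp add: F_def order_less_imp_not_eq2)
      show "(\<lambda>m. A m k $$ (i, j)) \<longlonglongrightarrow> A0 k $$ (i, j)"
        if "k \<in> set [0..<d]" "i < ns ! k" "j < rs ! k" for k i j
      proof -
        have "(\<lambda>m. A0 k $$ (i, j) + t m * A' k $$ (i, j)) \<longlonglongrightarrow> A0 k $$ (i, j) + 0 * A' k $$ (i, j)"
          by (intro tendsto_intros t0)
        then show ?thesis using that by (simp add: Aij)
      qed
      show "(\<lambda>m. (A m k $$ (i, j) - A0 k $$ (i, j)) / t m) \<longlonglongrightarrow> A' k $$ (i, j)"
        if "k \<in> set [0..<d]" "i < ns ! k" "j < rs ! k" for k i j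
        using t that by (simp add: Aij order_less_imp_not_eq2)
    qed (use A A0 A' in auto)
    moreover have "mode_prods [j \<leftarrow> [0..<d]. j \<noteq> k] (mode_prod G k (A' k)) A0 =
        mode_prods [j \<leftarrow> [0..<d]. j \<noteq> k] (mode_prod G k (Z k)) U" if "k < d" for k
      unfolding GA'[OF that]
    proof (rule mode_prods_cong_core)
      fix j assume "j \<in> set [j \<leftarrow> [0..<d]. j \<noteq> k]"
      then show "mode_prod (mode_prod G k (Z k)) j (A0 j) = mode_prod (mode_prod G k (Z k)) j (U j)"
        using GA0[of j] by (simp add: mode_prod_commute[of k j])
    qed simp
    ultimately show ?thesis
      unfolding X Y_def A0_def by (simp add: atLeast0LessThan)
  qed
  moreover have "(\<lambda>m. Y m is) \<longlonglongrightarrow> ?X is" for "is"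
  proof -
    have "(\<lambda>m. ?X is + t m * ((Y m is - ?X is) / t m)) \<longlonglongrightarrow> ?X is + 0 * ?V is"
      by (intro tendsto_add tendsto_mult tendsto_const t0 quot)
    then show ?thesis using t by (simp add: order_less_imp_not_eq2)
  qed
  ultimately show ?thesis
    unfolding tangent_cone_def using t t0
    by (intro CollectI exI[of _ t] exI[of _ Y]) (simp add: fun_tendsto_iff)
qed

section \<open>Normal components of tangent vectors\<close>

lemma tucker_variety_projector:
  assumes Y: "Y \<in> tucker_variety ns rs" and k: "k < length ns" and le: "rs ! k \<le> ns ! k"
  obtains W where "W \<in> stiefel (rs ! k) (ns ! k)" "mode_prod Y k (W * transpose_mat W) = Y"
proof -
  have YT: "Y \<in> tensors ns" using Y by (simp add: tucker_variety_def)
  have "vec_space.rank (ns ! k) (unfold_mode ns k Y) \<le> rs ! k"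
    using Y k by (auto simp: tucker_variety_def tucker_rank_def list_all2_conv_all_nth)
  then obtain W where W: "W \<in> stiefel (rs ! k) (ns ! k)"
    and WY: "W * transpose_mat W * unfold_mode ns k Y = unfold_mode ns k Y"
    using low_rank_projector[OF unfold_mode_carrier _ le] by blast
  let ?P = "W * transpose_mat W"
  have P: "?P \<in> carrier_mat (ns ! k) (ns ! k)" using stiefelD[OF W] by simp
  have "mode_prod Y k ?P = Y"
  proof (rule unfold_mode_inject[OF _ YT k])
    show "mode_prod Y k ?P \<in> tensors ns" by (rule mode_prod_square_in_tensors[OF YT k P])
    show "unfold_mode ns k (mode_prod Y k ?P) = unfold_mode ns k Y"
      using unfold_mode_mode_prod[OF k P] WY by simp
  qed
  then show ?thesis using that W by blast
qed

text \<open>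
  The matrices \<open>Q\<close> express membership in the row space: if \<open>M * Q = M\<close> holds for every \<open>Q\<close> that fixes the
  unfolding of \<open>X\<close> from the right, then the rows of \<open>M\<close> lie in its row space. In this form the condition
  is an equation between entries, which passes to the limit.
\<close>

lemma tangent_cone_normal_rows:
  assumes V: "V \<in> tangent_cone (tucker_variety ns rs) X" and X: "X \<in> tensors ns"
    and le: "\<And>k. k < length ns \<Longrightarrow> rs ! k \<le> ns ! k"
  obtains W where "\<And>k. k < length ns \<Longrightarrow> W k \<in> stiefel (rs ! k) (ns ! k)"
    "\<And>k. k < length ns \<Longrightarrow> mode_prod X k (W k * transpose_mat (W k)) = X"
    "\<And>k Q. k < length ns \<Longrightarrow>
      Q \<in> carrier_mat (length (unfolding_cols ns k)) (length (unfolding_cols ns k)) \<Longrightarrow>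
      unfold_mode ns k X * Q = unfold_mode ns k X \<Longrightarrow>
      unfold_mode ns k (mode_prod V k (1\<^sub>m (ns ! k) - W k * transpose_mat (W k))) * Q =
      unfold_mode ns k (mode_prod V k (1\<^sub>m (ns ! k) - W k * transpose_mat (W k)))"
proof -
  obtain t :: "nat \<Rightarrow> real" and Y :: "nat \<Rightarrow> tensor" where t: "\<And>m. 0 < t m"
    and Y: "\<And>m. Y m \<in> tucker_variety ns rs" and YX: "Y \<longlonglongrightarrow> X"
    and quot: "(\<lambda>m is. (Y m is - X is) / t m) \<longlonglongrightarrow> V"
    using V by (auto simp: tangent_cone_def)
  have YT: "Y m \<in> tensors ns" for m using Y[of m] by (simp add: tucker_variety_def)
  have "\<exists>W. W \<in> stiefel (rs ! k) (ns ! k) \<and> mode_prod (Y m) k (W * transpose_mat W) = Y m"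
    if "k < length ns" for m k
    using tucker_variety_projector[OF Y that le[OF that]] by blast
  then have "\<forall>m k. \<exists>W. k < length ns \<longrightarrow>
      W \<in> stiefel (rs ! k) (ns ! k) \<and> mode_prod (Y m) k (W * transpose_mat W) = Y m" by blast
  then obtain W where W: "\<And>m k. k < length ns \<Longrightarrow> W m k \<in> stiefel (rs ! k) (ns ! k)"
    and WY: "\<And>m k. k < length ns \<Longrightarrow> mode_prod (Y m) k (W m k * transpose_mat (W m k)) = Y m"
    by metis
  obtain s :: "nat \<Rightarrow> nat" and W0 where s: "strict_mono s"
    and W0: "\<And>k. k < length ns \<Longrightarrow> W0 k \<in> stiefel (rs ! k) (ns ! k)"
    and lim: "\<And>k i j. k < length ns \<Longrightarrow> i < ns ! k \<Longrightarrow> j < rs ! k \<Longrightarrow>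
      (\<lambda>m. W (s m) k $$ (i, j)) \<longlonglongrightarrow> W0 k $$ (i, j)"
    using stiefel_convergent_subsequence[of "length ns" W "(!) rs" "(!) ns"] W by blast
  define P where "P m k = W (s m) k * transpose_mat (W (s m) k)" for m k
  define P0 where "P0 k = W0 k * transpose_mat (W0 k)" for k
  define D where "D m = (\<lambda>is. (Y (s m) is - X is) / t (s m))" for m
  have YX': "(\<lambda>m. Y (s m) is) \<longlonglongrightarrow> X is" for "is"
    using LIMSEQ_subseq_LIMSEQ[OF YX s] by (simp add: fun_tendsto_iff o_def)
  have DV: "(\<lambda>m. D m is) \<longlonglongrightarrow> V is" for "is"
    using LIMSEQ_subseq_LIMSEQ[OF quot s] by (simp add: fun_tendsto_iff o_def D_def)
  have P: "P m k \<in> carrier_mat (ns ! k) (ns ! k)" if "k < length ns" for m k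
    unfolding P_def by (rule mult_carrier_mat[OF stiefelD(1,2)[OF W[OF that]]])
  have P0: "P0 k \<in> carrier_mat (ns ! k) (ns ! k)" if "k < length ns" for k
    using stiefelD[OF W0[OF that]] by (simp add: P0_def)
  have limP: "(\<lambda>m. P m k $$ (i, j)) \<longlonglongrightarrow> P0 k $$ (i, j)"
    if "k < length ns" "i < ns ! k" "j < ns ! k" for k i j
    unfolding P_def P0_def
  proof (rule mult_mat_tendsto)
    show "(\<lambda>m. transpose_mat (W (s m) k) $$ (i, j)) \<longlonglongrightarrow> transpose_mat (W0 k) $$ (i, j)"
      if "i < rs ! k" "j < ns ! k" for i j
      using lim \<open>k < length ns\<close> that
      by (simp add: carrier_matD[OF stiefelD(1)[OF W]] carrier_matD[OF stiefelD(1)[OF W0]])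
  qed (use that lim stiefelD[OF W] stiefelD[OF W0] in auto)
  have XP0: "mode_prod X k (P0 k) = X" if k: "k < length ns" for k
  proof
    fix "is"
    have "(\<lambda>m. mode_prod (Y (s m)) k (P m k) is) \<longlonglongrightarrow> mode_prod X k (P0 k) is"
      using YX' P[OF k] P0[OF k] limP[OF k] by (rule mode_prod_tendsto)
    then have "(\<lambda>m. Y (s m) is) \<longlonglongrightarrow> mode_prod X k (P0 k) is"
      using WY[OF k] by (simp add: P_def)
    then show "mode_prod X k (P0 k) is = X is" using YX' by (rule LIMSEQ_unique)
  qed
  have "unfold_mode ns k (mode_prod V k (1\<^sub>m (ns ! k) - P0 k)) * Q =
      unfold_mode ns k (mode_prod V k (1\<^sub>m (ns ! k) - P0 k))"
    if k: "k < length ns"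
      and Q: "Q \<in> carrier_mat (length (unfolding_cols ns k)) (length (unfolding_cols ns k))"
      and XQ: "unfold_mode ns k X * Q = unfold_mode ns k X" for k Q
  proof -
    let ?c = "length (unfolding_cols ns k)"
    define N where "N m = 1\<^sub>m (ns ! k) - P m k" for m
    define N0 where "N0 = 1\<^sub>m (ns ! k) - P0 k"
    define M where "M m = unfold_mode ns k (mode_prod (D m) k (N m))" for m
    define M0 where "M0 = unfold_mode ns k (mode_prod V k N0)"
    have N: "N m \<in> carrier_mat (ns ! k) (ns ! k)" for m
      unfolding N_def using P[OF k] by (rule minus_carrier_mat)
    have N0: "N0 \<in> carrier_mat (ns ! k) (ns ! k)"
      unfolding N0_def using P0[OF k] by (rule minus_carrier_mat)
    have Mc: "M m \<in> carrier_mat (ns ! k) ?c" and M0c: "M0 \<in> carrier_mat (ns ! k) ?c" for m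
      unfolding M_def M0_def by (rule unfold_mode_carrier)+
    have limM: "(\<lambda>m. M m $$ (i, j)) \<longlonglongrightarrow> M0 $$ (i, j)" if ij: "i < ns ! k" "j < ?c" for i j
    proof -
      have "(\<lambda>m. N m $$ (i, j)) \<longlonglongrightarrow> N0 $$ (i, j)" if "i < ns ! k" "j < ns ! k" for i j
        using that limP[OF k that] P[OF k] P0[OF k]
        by (simp add: N_def N0_def carrier_matD[OF P[OF k]] carrier_matD[OF P0[OF k]] tendsto_diff)
      then have "(\<lambda>m. mode_prod (D m) k (N m) is) \<longlonglongrightarrow> mode_prod V k N0 is" for "is"
        by (rule mode_prod_tendsto[OF DV N N0])
      then show ?thesis using ij by (simp add: M_def M0_def unfold_mode_def)
    qed
    have MQ: "M m * Q = M m" for m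
    proof -
      \<comment> \<open>As \<open>Y (s m)\<close> has no component along \<open>N m\<close>, that of the quotient \<open>D m\<close> comes from \<open>X\<close> alone.\<close>
      have "mode_prod (Y (s m)) k (N m) is = 0" for "is"
        using mode_prod_add_complement[OF YT[of "s m"] k P[OF k, of m], of "is"] WY[OF k]
        by (simp add: P_def N_def)
      moreover have "D m = (\<lambda>is. (1 / t (s m)) * (Y (s m) is + -1 * X is))"
        by (simp add: D_def fun_eq_iff)
      ultimately have "mode_prod (D m) k (N m) = (\<lambda>is. - (1 / t (s m)) * mode_prod X k (N m) is)"
        by (simp only: mode_prod_scale mode_prod_add) simp
      then have "M m = - (1 / t (s m)) \<cdot>\<^sub>m (N m * unfold_mode ns k X)"
        using unfold_mode_mode_prod[OF k N[of m]] by (simp only: M_def unfold_mode_scale) simp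
      moreover have "N m * unfold_mode ns k X * Q = N m * unfold_mode ns k X"
        using assoc_mult_mat[OF N unfold_mode_carrier Q] XQ by simp
      ultimately show ?thesis
        using mult_smult_assoc_mat[OF mult_carrier_mat[OF N unfold_mode_carrier] Q] by simp
    qed
    have "M0 * Q = M0"
    proof (rule eq_matI)
      fix i j assume "i < dim_row M0" "j < dim_col M0"
      then have ij: "i < ns ! k" "j < ?c" using M0c by auto
      have "(\<lambda>m. (M m * Q) $$ (i, j)) \<longlonglongrightarrow> (M0 * Q) $$ (i, j)"
        by (rule mult_mat_tendsto[OF Mc M0c Q Q limM _ ij]) auto
      then have "(\<lambda>m. M m $$ (i, j)) \<longlonglongrightarrow> (M0 * Q) $$ (i, j)" by (simp only: MQ)
      then show "(M0 * Q) $$ (i, j) = M0 $$ (i, j)" using limM[OF ij] LIMSEQ_unique by blast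
    qed (use M0c Q in auto)
    then show ?thesis by (simp add: M0_def N0_def)
  qed
  then show ?thesis using that W0 XP0 unfolding P0_def by blast
qed

section \<open>Assembling the tangent vector\<close>

text \<open>
  Here \<open>T k\<close> is the component of \<open>V\<close> that \<open>P k\<close> removes. Being fixed by the projectors of the other modes,
  it passes unchanged through the projections already applied.
\<close>

lemma tensor_telescope:
  assumes split: "\<And>k. k < n \<Longrightarrow> V = (\<lambda>is. mode_prod V k (P k) is + T k is)"
    and fix_T: "\<And>j k. k < n \<Longrightarrow> j < n \<Longrightarrow> j \<noteq> k \<Longrightarrow> mode_prod (T k) j (P j) = T k"
  shows "V = (\<lambda>is. mode_prods [0..<n] V P is + (\<Sum>k<n. T k is))"
  using assms
proof (induction n)
  case (Suc n)
  let ?L = "[0..<n]"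
  have "mode_prods ks (T n) P = T n" if "set ks \<subseteq> {..<n}" for ks
    using that by (induction ks) (use Suc.prems(2) in auto)
  from this[of ?L] have "mode_prods ?L (T n) P = T n" by (auto simp: atLeast0LessThan)
  moreover have "mode_prods ?L V P =
      (\<lambda>is. mode_prods ?L (mode_prod V n (P n)) P is + mode_prods ?L (T n) P is)"
    unfolding mode_prods_add[symmetric] using Suc.prems(1)[of n] by simp
  moreover have "mode_prods ?L (mode_prod V n (P n)) P = mode_prods [0..<Suc n] V P"
    by (simp add: mode_prods_snoc mode_prods_mode_prod)
  ultimately have step: "mode_prods ?L V P = (\<lambda>is. mode_prods [0..<Suc n] V P is + T n is)"
    by simp
  have "V = (\<lambda>is. mode_prods ?L V P is + (\<Sum>k<n. T k is))"
    by (rule Suc.IH) (use Suc.prems in auto)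
  also have "\<dots> = (\<lambda>is. mode_prods [0..<Suc n] V P is + (\<Sum>k<Suc n. T k is))"
    unfolding step by (simp add: fun_eq_iff)
  finally show ?case .
qed simp

text \<open>
  Let \<open>X\<^sub>k = U\<^sub>k B\<close> be the mode-\<open>k\<close> unfolding and \<open>H\<close> a right inverse of \<open>B\<close>; it exists because \<open>X\<^sub>k\<close> has
  rank \<open>rs' ! k\<close>. Then \<open>U\<^sub>k = X\<^sub>k H\<close>, so the projector fixing \<open>X\<close> in mode \<open>k\<close> also fixes \<open>U\<^sub>k\<close>. Moreover
  \<open>H B\<close> fixes \<open>X\<^sub>k\<close> from the right, hence also the unfolding \<open>N V\<^sub>k\<close> of the normal component, where
  \<open>N = U2 U2\<^sup>T\<close>. Thus \<open>N V\<^sub>k = N V\<^sub>k H B = U2 R2 B\<close> with \<open>R2 = U2\<^sup>T V\<^sub>k H\<close>.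
\<close>

lemma tangent_vector_decomposition:
  fixes ns rs rs' :: "nat list"
  defines "d \<equiv> length ns"
  assumes len: "length rs = d" "length rs' = d"
    and le': "\<And>k. k < d \<Longrightarrow> rs' ! k \<le> rs ! k" and le: "\<And>k. k < d \<Longrightarrow> rs ! k \<le> ns ! k"
    and U: "\<And>k. k < d \<Longrightarrow> U k \<in> stiefel (rs' ! k) (ns ! k)"
    and G: "G \<in> tensors rs'" and X: "X \<in> tensors ns" "X = mode_prods [0..<d] G U" and rank: "tucker_rank ns X = rs'"
    and V: "V \<in> tensors ns" "V \<in> tangent_cone (tucker_variety ns rs) X"
  obtains C R2 U1 U2 where "C \<in> tensors rs"
    "\<And>k. k < d \<Longrightarrow> R2 k \<in> carrier_mat (ns ! k - rs ! k) (rs' ! k)"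
    "\<And>k. k < d \<Longrightarrow> U1 k \<in> stiefel (rs ! k - rs' ! k) (ns ! k)"
    "\<And>k. k < d \<Longrightarrow> U2 k \<in> stiefel (ns ! k - rs ! k) (ns ! k)"
    "\<And>k. k < d \<Longrightarrow> U k @\<^sub>c U1 k @\<^sub>c U2 k \<in> orthogonal_matrices (ns ! k)"
    "V = (\<lambda>is. mode_prods [0..<d] C (\<lambda>k. U k @\<^sub>c U1 k) is +
      (\<Sum>k<d. mode_prods [j \<leftarrow> [0..<d]. j \<noteq> k] (mode_prod G k (U2 k * R2 k)) U is))"
proof -
  obtain W where W: "\<And>k. k < d \<Longrightarrow> W k \<in> stiefel (rs ! k) (ns ! k)"
    and WX: "\<And>k. k < d \<Longrightarrow> mode_prod X k (W k * transpose_mat (W k)) = X"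
    and normal: "\<And>k Q. k < d \<Longrightarrow>
      Q \<in> carrier_mat (length (unfolding_cols ns k)) (length (unfolding_cols ns k)) \<Longrightarrow>
      unfold_mode ns k X * Q = unfold_mode ns k X \<Longrightarrow>
      unfold_mode ns k (mode_prod V k (1\<^sub>m (ns ! k) - W k * transpose_mat (W k))) * Q =
      unfold_mode ns k (mode_prod V k (1\<^sub>m (ns ! k) - W k * transpose_mat (W k)))"
    using tangent_cone_normal_rows[OF V(2) X(1)] le unfolding d_def by blast
  define P where "P k = W k * transpose_mat (W k)" for k
  have P: "P k \<in> carrier_mat (ns ! k) (ns ! k)" if "k < d" for k
    using stiefelD[OF W[OF that]] by (simp add: P_def)
  define T where "T k Z = mode_prods [j \<leftarrow> [0..<d]. j \<noteq> k] (mode_prod G k Z) U" for k Z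
  have T_eq: "T k Z = mode_prod (mode_prods [j \<leftarrow> [0..<d]. j \<noteq> k] G U) k Z" for k Z
    unfolding T_def by (rule mode_prods_mode_prod) simp
  define good where "good k U1 U2 R2 \<longleftrightarrow> R2 \<in> carrier_mat (ns ! k - rs ! k) (rs' ! k) \<and>
      U1 \<in> stiefel (rs ! k - rs' ! k) (ns ! k) \<and> U2 \<in> stiefel (ns ! k - rs ! k) (ns ! k) \<and>
      U k @\<^sub>c U1 @\<^sub>c U2 \<in> orthogonal_matrices (ns ! k) \<and>
      (U k @\<^sub>c U1) * transpose_mat (U k @\<^sub>c U1) = P k \<and> P k * U k = U k \<and>
      V = (\<lambda>is. mode_prod V k (P k) is + T k (U2 * R2) is)" for k U1 U2 R2
  have "\<exists>U1 U2 R2. good k U1 U2 R2" if k: "k < d" for k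
  proof -
    have kn: "k < length ns" using k by (simp add: d_def)
    let ?n = "ns ! k" and ?r = "rs' ! k" and ?c = "length (unfolding_cols ns k)"
    define B where "B = unfold_mode (ns[k := ?r]) k (mode_prods [j \<leftarrow> [0..<d]. j \<noteq> k] G U)"
    define Xk where "Xk = unfold_mode ns k X"
    define Vk where "Vk = unfold_mode ns k V"
    define N where "N = 1\<^sub>m ?n - P k"
    note Uc = stiefelD[OF U[OF k]]
    have B: "B \<in> carrier_mat ?r ?c"
      using unfold_mode_carrier[of "ns[k := ?r]" k] kn by (simp add: B_def)
    have Xkc: "Xk \<in> carrier_mat ?n ?c" and Vkc: "Vk \<in> carrier_mat ?n ?c"
      unfolding Xk_def Vk_def by (rule unfold_mode_carrier)+
    have N: "N \<in> carrier_mat ?n ?n" unfolding N_def using P[OF k] by (rule minus_carrier_mat)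
    have unfold_T: "unfold_mode ns k (T k Z) = Z * B" if "Z \<in> carrier_mat ?n ?r" for Z
      unfolding T_eq B_def by (rule unfold_mode_mode_prod[OF kn that])
    have T_tensor: "T k Z \<in> tensors ns" if "Z \<in> carrier_mat ?n ?r" for Z
    proof -
      have "T k Z = mode_prods [0..<d] G (U(k := Z))"
        unfolding T_def using k
        by (subst mode_prods_isolate'[of _ k]) (auto intro: mode_prods_cong)
      moreover have "dim_row ((U(k := Z)) j) = ns ! j" if "j < length ns" for j
        using stiefelD(1)[OF U, of j] that \<open>Z \<in> _\<close> by (auto simp: d_def)
      ultimately show ?thesis
        using mode_prods_in_tensors[OF G] len(2) by (simp add: d_def)
    qed
    have "X = T k (U k)"
      unfolding X(2) T_def using k by (intro mode_prods_isolate') auto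
    then have XB: "Xk = U k * B" using unfold_T[OF Uc(1)] by (simp add: Xk_def)
    have "vec_space.rank ?n Xk = ?r"
      using rank kn by (auto simp: tucker_rank_def Xk_def)
    then obtain H where H: "H \<in> carrier_mat ?c ?r" and BH: "B * H = 1\<^sub>m ?r"
      using full_rank_right_inverse[OF Uc(1) B] XB by metis
    have XH: "Xk * H = U k"
      unfolding XB using assoc_mult_mat[OF Uc(1) B H] BH Uc(1) by simp
    have "P k * Xk = Xk"
      using unfold_mode_mode_prod[OF kn P[OF k], of X] WX[OF k] by (simp add: Xk_def P_def)
    then have PU: "P k * U k = U k"
      using assoc_mult_mat[OF P[OF k] Xkc H] XH by simp
    obtain U1 U2 where U1: "U1 \<in> stiefel (rs ! k - ?r) ?n" and U2: "U2 \<in> stiefel (?n - rs ! k) ?n"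
      and orth: "U k @\<^sub>c U1 @\<^sub>c U2 \<in> orthogonal_matrices ?n"
      and UP: "(U k @\<^sub>c U1) * transpose_mat (U k @\<^sub>c U1) = P k"
      and U2P: "P k + U2 * transpose_mat U2 = 1\<^sub>m ?n"
      using orthonormal_split[OF W[OF k] U[OF k] le'[OF k] le[OF k]] PU unfolding P_def by blast
    note U2c = stiefelD[OF U2]
    have NU2: "N = U2 * transpose_mat U2"
      unfolding N_def U2P[symmetric] using P[OF k] U2c by (intro eq_matI) auto
    define R2 where "R2 = transpose_mat U2 * (Vk * H)"
    have R2: "R2 \<in> carrier_mat (?n - rs ! k) ?r" using U2c Vkc H by (simp add: R2_def)
    have UR: "U2 * R2 = N * (Vk * H)"
      unfolding NU2 R2_def using assoc_mult_mat[OF U2c(1,2) mult_carrier_mat[OF Vkc H]] by simp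
    have HB: "H * B \<in> carrier_mat ?c ?c" using H B by simp
    have XHB: "Xk * (H * B) = Xk"
      using assoc_mult_mat[OF Xkc H B] XH XB by simp
    have "mode_prod V k N = T k (U2 * R2)"
    proof (rule unfold_mode_inject[OF _ _ kn])
      show "mode_prod V k N \<in> tensors ns" by (rule mode_prod_square_in_tensors[OF V(1) kn N])
      show "T k (U2 * R2) \<in> tensors ns" using U2c R2 by (intro T_tensor) simp
      have "unfold_mode ns k (mode_prod V k N) = N * Vk"
        unfolding Vk_def using unfold_mode_mode_prod[OF kn N] by simp
      then have "N * Vk * (H * B) = unfold_mode ns k (mode_prod V k N)"
        using normal[OF k HB] XHB by (simp add: Xk_def N_def P_def)
      moreover have "N * Vk * (H * B) = U2 * R2 * B"
        unfolding UR using assoc_mult_mat[OF mult_carrier_mat[OF N Vkc] H B]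
          assoc_mult_mat[OF N Vkc H] by simp
      moreover have "unfold_mode ns k (T k (U2 * R2)) = U2 * R2 * B"
        using U2c R2 by (intro unfold_T) simp
      ultimately show "unfold_mode ns k (mode_prod V k N) = unfold_mode ns k (T k (U2 * R2))"
        by simp
    qed
    then have "V = (\<lambda>is. mode_prod V k (P k) is + T k (U2 * R2) is)"
      using mode_prod_add_complement[OF V(1) kn P[OF k]] by (auto simp: N_def fun_eq_iff)
    then show ?thesis unfolding good_def using R2 U1 U2 orth UP PU by blast
  qed
  then obtain U1 U2 R2 where good: "\<And>k. k < d \<Longrightarrow> good k (U1 k) (U2 k) (R2 k)" by metis
  then have R2: "\<And>k. k < d \<Longrightarrow> R2 k \<in> carrier_mat (ns ! k - rs ! k) (rs' ! k)"
    and U1: "\<And>k. k < d \<Longrightarrow> U1 k \<in> stiefel (rs ! k - rs' ! k) (ns ! k)"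
    and U2: "\<And>k. k < d \<Longrightarrow> U2 k \<in> stiefel (ns ! k - rs ! k) (ns ! k)"
    and orth: "\<And>k. k < d \<Longrightarrow> U k @\<^sub>c U1 k @\<^sub>c U2 k \<in> orthogonal_matrices (ns ! k)"
    and UP: "\<And>k. k < d \<Longrightarrow> (U k @\<^sub>c U1 k) * transpose_mat (U k @\<^sub>c U1 k) = P k"
    and PU: "\<And>k. k < d \<Longrightarrow> P k * U k = U k"
    and split: "\<And>k. k < d \<Longrightarrow> V = (\<lambda>is. mode_prod V k (P k) is + T k (U2 k * R2 k) is)"
    unfolding good_def by blast+
  have "V = (\<lambda>is. mode_prods [0..<d] V P is + (\<Sum>k<d. T k (U2 k * R2 k) is))"
  proof (rule tensor_telescope[OF split])
    fix j k assume jk: "k < d" "j < d" "j \<noteq> k"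
    have "T k (U2 k * R2 k) =
        mode_prod (mode_prods [i \<leftarrow> [i \<leftarrow> [0..<d]. i \<noteq> k]. i \<noteq> j] (mode_prod G k (U2 k * R2 k)) U) j (U j)"
      unfolding T_def using jk by (intro mode_prods_isolate) auto
    then show "mode_prod (T k (U2 k * R2 k)) j (P j) = T k (U2 k * R2 k)"
      using P[OF jk(2)] stiefelD(1)[OF U[OF jk(2)]] PU[OF jk(2)]
      by (simp add: mode_prod_mode_prod)
  qed
  moreover define C where "C = mode_prods [0..<d] V (\<lambda>k. transpose_mat (U k @\<^sub>c U1 k))"
  have UU1: "U k @\<^sub>c U1 k \<in> carrier_mat (ns ! k) (rs ! k)" if "k < d" for k
    using append_cols_carrier[OF stiefelD(1)[OF U[OF that]] stiefelD(1)[OF U1[OF that]]] le'[OF that]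
    by simp
  have "mode_prods [0..<d] C (\<lambda>k. U k @\<^sub>c U1 k) = mode_prods [0..<d] V P"
  proof -
    have "mode_prods [0..<d] C (\<lambda>k. U k @\<^sub>c U1 k) =
        mode_prods [0..<d] V (\<lambda>k. (U k @\<^sub>c U1 k) * transpose_mat (U k @\<^sub>c U1 k))"
      unfolding C_def by (intro mode_prods_mode_prods) auto
    also have "\<dots> = mode_prods [0..<d] V P" using UP by (intro mode_prods_cong) auto
    finally show ?thesis .
  qed
  moreover have "C \<in> tensors rs"
    unfolding C_def len(1)[symmetric]
    by (rule mode_prods_in_tensors[OF V(1)]) (use len carrier_matD[OF UU1] in \<open>auto simp: d_def\<close>)
  ultimately show ?thesis
    using that[of C R2 U1 U2] R2 U1 U2 orth by (simp add: T_def)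
qed

theorem theorem1:
  fixes d :: nat and ns rs rs' :: "nat list"
    and X G V :: tensor and U :: "nat \<Rightarrow> real mat"
  assumes "0 < d" and "length ns = d" and "length rs = d"
    and "\<forall>k<d. 0 < ns ! k" and "\<forall>k<d. 0 < rs ! k" and "\<forall>k<d. rs ! k \<le> ns ! k"
    and "X \<in> tensors ns" and "tucker_rank ns X = rs'" and "list_all2 (\<le>) rs' rs"
    and "G \<in> tensors rs'" and "\<forall>k<d. U k \<in> stiefel (rs' ! k) (ns ! k)"
    and "X = mode_prods [0..<d] G U"
    and "V \<in> tensors ns"
  shows "V \<in> tangent_cone (tucker_variety ns rs) X \<longleftrightarrow>
    (\<exists>(C :: tensor) (R2 :: nat \<Rightarrow> real mat) (U1 :: nat \<Rightarrow> real mat) (U2 :: nat \<Rightarrow> real mat).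
       C \<in> tensors rs \<and>
       (\<forall>k<d. R2 k \<in> carrier_mat (ns ! k - rs ! k) (rs' ! k) \<and>
              U1 k \<in> stiefel (rs ! k - rs' ! k) (ns ! k) \<and>
              U2 k \<in> stiefel (ns ! k - rs ! k) (ns ! k) \<and>
              U k @\<^sub>c U1 k @\<^sub>c U2 k \<in> orthogonal_matrices (ns ! k)) \<and>
       V = (\<lambda>is. mode_prods [0..<d] C (\<lambda>k. U k @\<^sub>c U1 k) is +
              (\<Sum>k<d. mode_prods [j \<leftarrow> [0..<d]. j \<noteq> k] (mode_prod G k (U2 k * R2 k)) U is)))"
  (is "_ \<longleftrightarrow> ?decomposable")
proof
  have len: "length rs = length ns" "length rs' = length ns"
    and le': "\<And>k. k < length ns \<Longrightarrow> rs' ! k \<le> rs ! k"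
    using assms(2,3,9) by (auto simp: list_all2_conv_all_nth)
  have U: "\<And>k. k < length ns \<Longrightarrow> U k \<in> stiefel (rs' ! k) (ns ! k)"
    and le: "\<And>k. k < length ns \<Longrightarrow> rs ! k \<le> ns ! k"
    using assms by auto
  {
    assume V: "V \<in> tangent_cone (tucker_variety ns rs) X"
    have X: "X = mode_prods [0..<length ns] G U" using assms by simp
    show ?decomposable
      by (rule tangent_vector_decomposition[OF len le' le U assms(10,7) X assms(8,13) V])
        (use assms(2) in blast)+
  next
    assume ?decomposable
    then obtain C R2 U1 U2 where C: "C \<in> tensors rs"
      and R2: "\<And>k. k < length ns \<Longrightarrow> R2 k \<in> carrier_mat (ns ! k - rs ! k) (rs' ! k)"
      and U1: "\<And>k. k < length ns \<Longrightarrow> U1 k \<in> stiefel (rs ! k - rs' ! k) (ns ! k)"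
      and U2: "\<And>k. k < length ns \<Longrightarrow> U2 k \<in> stiefel (ns ! k - rs ! k) (ns ! k)"
      and V: "V = (\<lambda>is. mode_prods [0..<length ns] C (\<lambda>k. U k @\<^sub>c U1 k) is +
        (\<Sum>k<length ns. mode_prods [j \<leftarrow> [0..<length ns]. j \<noteq> k] (mode_prod G k (U2 k * R2 k)) U is))"
      using assms(2) by blast
    show "V \<in> tangent_cone (tucker_variety ns rs) X"
      unfolding V assms(12) assms(2)[symmetric]
      by (rule tucker_curve_tangent[OF len le' assms(10) C])
        (auto intro: stiefelD(1) U U1 mult_carrier_mat[OF stiefelD(1)[OF U2] R2])
  }
qed

end
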